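(* For any minimally non-$O(n^{d-1})$ $d$-dimensional 0-1 matrix of dimensions $k_1 \times k_2 \times \dots \times k_d$ with $k_1 \le k_2 \le \dots \le k_d$, $$k_d \le 1+2 \sum_{i=1}^{d-1} (2k_i - 2).$$
   Context: A $d$-dimensional 0-1 matrix $A$ contains a $d$-dimensional 0-1 matrix $P$ if $A$ has a submatrix (obtained by restricting each of the $d$ coordinates to a subset of its range) of the same dimensions as $P$ that can be turned into $P$ by changing any number of $1$-entries to $0$-entries; otherwise $A$ avoids $P$ (is $P$-free). $P'$ is properly contained in $P$ if $P$ contains $P'$ and $P'\neq P$. $\operatorname{ex}(n,P,d)$ is the maximum possible number of $1$-entries in a $P$-free $d$-dimensional 0-1 matrix of dimensions $n\times n\times\dots\times n$ (taken to be $0$ if no such matrix exists). A $d$-dimensional 0-1 matrix $P$ is minimally non-$O(n^{d-1})$ if $\operatorname{ex}(n,P,d)=\omega(n^{d-1})$ but $\operatorname{ex}(n,P',d)=O(n^{d-1})$ for every $d$-dimensional 0-1 matrix $P'$ properly contained in $P$. Asymptotics are for $n\to\infty$ with the forbidden matrix and $d$ fixed. *)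

theory Defs
  imports Complex_Main "HOL-Library.Landau_Symbols"
begin

text \<open>
  A multidimensional 0-1 matrix is given by the list of its side lengths and the set of positions
  of its 1-entries. A position is a list of coordinates, which are counted from 0. For well-formed
  matrices (\<open>zo_matrix\<close> below) this representation is unique, so equality of values is equality of
  matrices.
\<close>

datatype zomat = ZOMat (dims: "nat list") (ones: "nat list set")

definition positions :: "nat list \<Rightarrow> nat list set" where
  "positions ks = {x. list_all2 (<) x ks}"

definition zo_matrix :: "nat \<Rightarrow> zomat \<Rightarrow> bool" where
  "zo_matrix d A \<longleftrightarrow>
     length (dims A) = d \<and> (\<forall>k \<in> set (dims A). 0 < k) \<and> ones A \<subseteq> positions (dims A)"

text \<open>
  In the submatrix given by coordinate sets \<open>Ss\<close>, index \<open>i\<close> in a coordinate with set \<open>S\<close> refers to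
  the \<open>i\<close>-th smallest element of \<open>S\<close>.
\<close>

definition submatrix :: "nat set list \<Rightarrow> zomat \<Rightarrow> zomat" where
  "submatrix Ss A =
     ZOMat (map card Ss)
       {x \<in> positions (map card Ss). map2 (\<lambda>S i. sorted_list_of_set S ! i) Ss x \<in> ones A}"

definition contains :: "zomat \<Rightarrow> zomat \<Rightarrow> bool" where
  "contains A P \<longleftrightarrow>
     (\<exists>Ss. list_all2 (\<lambda>S n. S \<subseteq> {..<n}) Ss (dims A) \<and>
           dims (submatrix Ss A) = dims P \<and> ones P \<subseteq> ones (submatrix Ss A))"

definition properly_contains :: "zomat \<Rightarrow> zomat \<Rightarrow> bool" where
  "properly_contains P P' \<longleftrightarrow> contains P P' \<and> P' \<noteq> P"

definition free_matrices :: "nat \<Rightarrow> zomat \<Rightarrow> nat \<Rightarrow> zomat set" where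
  "free_matrices n P d = {A. zo_matrix d A \<and> dims A = replicate d n \<and> \<not> contains A P}"

definition ex_num :: "nat \<Rightarrow> zomat \<Rightarrow> nat \<Rightarrow> nat" where
  "ex_num n P d =
     (if free_matrices n P d = {} then 0 else Max ((\<lambda>A. card (ones A)) ` free_matrices n P d))"

lemma finite_positions: "finite (positions ks)"
proof (rule finite_subset)
  show "positions ks \<subseteq> {x. set x \<subseteq> {..Max (set ks)} \<and> length x = length ks}"
    by (fastforce simp: positions_def list_all2_conv_all_nth in_set_conv_nth
          intro: order.trans[OF less_imp_le Max_ge])
  show "finite {x. set x \<subseteq> {..Max (set ks)} \<and> length x = length ks}"
    by (rule finite_lists_length_eq) simp
qed

text \<open>In particular, the maximum in \<open>ex_num\<close> is taken over a finite set.\<close>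

lemma finite_free_matrices: "finite (free_matrices n P d)"
proof (rule finite_subset)
  show "free_matrices n P d \<subseteq> ZOMat (replicate d n) ` Pow (positions (replicate d n))"
  proof
    fix A assume "A \<in> free_matrices n P d"
    then show "A \<in> ZOMat (replicate d n) ` Pow (positions (replicate d n))"
      by (cases A) (auto simp: free_matrices_def zo_matrix_def)
  qed
  show "finite (ZOMat (replicate d n) ` Pow (positions (replicate d n)))"
    by (simp add: finite_positions)
qed

definition minimally_non_O :: "nat \<Rightarrow> zomat \<Rightarrow> bool" where
  "minimally_non_O d P \<longleftrightarrow>
     zo_matrix d P \<and>
     (\<lambda>n. real (ex_num n P d)) \<in> \<omega>(\<lambda>n. real n ^ (d - 1)) \<and>
     (\<forall>P'. zo_matrix d P' \<longrightarrow> properly_contains P P' \<longrightarrow>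
        (\<lambda>n. real (ex_num n P' d)) \<in> O(\<lambda>n. real n ^ (d - 1)))"

end

theory Submission
  imports Defs
begin

text \<open>
  Look at the layers of \<open>P\<close> in the last coordinate. Thinning a \<open>P\<close>-free matrix along the lines in
  that direction shows that no layer of a minimal \<open>P\<close> is empty, and that if a layer consists of a
  single 1-entry, then this entry does not continue into the preceding layer and also into the
  following one (where there is one). Choose a 1-entry in each layer, different from the one chosen
  in the preceding layer if possible. Then the chosen entries never repeat twice in succession, nor
  at the very end, so the number of layers is at most \<open>1 + 2 t\<close>, where \<open>t\<close> is the number of layers
  at which the chosen entry changes. If no coordinate of the chosen sequence contains the
  alternation \<open>abab\<close>, it has at most \<open>2 k\<^sub>i - 2\<close> changes in coordinate \<open>i\<close>, and the bound follows.
  Otherwise the four entries of an alternation already form a pattern that is not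
  \<open>O(n\<^bsup>d - 1\<^esup>)\<close>, because it projects to a two-dimensional pattern with superlinear
  extremal function. Hence \<open>P\<close> consists of these four entries and has only four layers.
\<close>

text \<open>Failure of \<open>O\<close> only asks, for every constant \<open>C\<close>, for
  arbitrarily large \<open>n\<close> with an \<open>n\<close> by \<open>n\<close> matrix that has at
  least \<open>C * n\<close> entries and no \<open>abab\<close>. So no growth rate is tracked; a
  double induction on the density and on the number of rows starting in a special column is enough.
  With \<open>e\<close> coordinates besides the last, extending such a matrix constantly along the
  other \<open>e - 1\<close> of them gives \<open>C * n ^ e\<close> entries. On the side of upper
  bounds, there are \<open>n ^ e\<close> lines in the last direction, so thinning may lose a
  constant factor and in addition a bounded number of entries per line.\<close>

section \<open>Superlinear matrices without abab\<close>

text \<open>An element of \<open>M\<close> is a pair of a row and a column.\<close>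

definition abab_free :: "(nat \<times> nat) set \<Rightarrow> bool" where
  "abab_free M \<longleftrightarrow> (\<forall>a b c1 c2 c3 c4. a < b \<longrightarrow> c1 < c2 \<longrightarrow> c2 < c3 \<longrightarrow> c3 < c4 \<longrightarrow>
     (a, c1) \<in> M \<longrightarrow> (b, c2) \<in> M \<longrightarrow> (a, c3) \<in> M \<longrightarrow> (b, c4) \<in> M \<longrightarrow> False)"

text \<open>
  The columns in \<open>S\<close> contain first occurrences only. The last clause says that two rows that start
  in the same such column reappear in reverse order only; it is what excludes \<open>abab\<close> when first
  occurrences are spread over several new columns in \<open>fan_compose\<close>.
\<close>

definition fan :: "nat \<Rightarrow> (nat \<times> nat) set \<Rightarrow> nat set \<Rightarrow> bool" where
  "fan m M S \<longleftrightarrow> finite M \<and> finite S \<and> abab_free M \<and>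
     (\<forall>c\<in>S. card {r. (r, c) \<in> M} = m) \<and>
     (\<forall>r c c'. c \<in> S \<longrightarrow> (r, c) \<in> M \<longrightarrow> (r, c') \<in> M \<longrightarrow> c \<le> c') \<and>
     (\<forall>a b c c1 c2. a < b \<longrightarrow> c \<in> S \<longrightarrow> (a, c) \<in> M \<longrightarrow> (b, c) \<in> M \<longrightarrow>
        c < c1 \<longrightarrow> c1 < c2 \<longrightarrow> (a, c1) \<in> M \<longrightarrow> (b, c2) \<in> M \<longrightarrow> False)"

lemma abab_freeD:
  "\<lbrakk>abab_free M; a < b; c1 < c2; c2 < c3; c3 < c4;
    (a, c1) \<in> M; (b, c2) \<in> M; (a, c3) \<in> M; (b, c4) \<in> M\<rbrakk> \<Longrightarrow> False"
  unfolding abab_free_def by blast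

lemma fan_free: "fan m M S \<Longrightarrow> abab_free M"
  and fan_finite: "fan m M S \<Longrightarrow> finite M" "fan m M S \<Longrightarrow> finite S"
  and fan_card: "\<lbrakk>fan m M S; c \<in> S\<rbrakk> \<Longrightarrow> card {r. (r, c) \<in> M} = m"
  and fan_first: "\<lbrakk>fan m M S; c \<in> S; (r, c) \<in> M; (r, c') \<in> M\<rbrakk> \<Longrightarrow> c \<le> c'"
  unfolding fan_def by blast+

lemma fan_after:
  "\<lbrakk>fan m M S; a < b; c \<in> S; (a, c) \<in> M; (b, c) \<in> M; c < c1; c1 < c2; (a, c1) \<in> M; (b, c2) \<in> M\<rbrakk>
    \<Longrightarrow> False"
  unfolding fan_def by blast

text \<open>Under \<open>mono\<close>, an entry of a row \<open>b\<close> is never followed in a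
  later column by an entry of a row \<open>a < b\<close>. Both \<open>abab\<close> and the last
  clause of \<open>fan\<close> contain such a pair.\<close>

lemma fan_monotone:
  assumes "finite M" "finite S" "\<And>c. c \<in> S \<Longrightarrow> card {r. (r, c) \<in> M} = m"
    and "\<And>r c c'. \<lbrakk>c \<in> S; (r, c) \<in> M; (r, c') \<in> M\<rbrakk> \<Longrightarrow> c \<le> c'"
    and mono: "\<And>a b c c'. \<lbrakk>a < b; (a, c) \<in> M; (b, c') \<in> M\<rbrakk> \<Longrightarrow> c \<le> c'"
  shows "fan m M S"
proof -
  have "abab_free M" unfolding abab_free_def
  proof (intro allI impI)
    fix a b c1 c2 c3 c4 :: nat
    assume "a < b" "c2 < c3" "(b, c2) \<in> M" "(a, c3) \<in> M"
    then show False using mono[of a b c3 c2] by simp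
  qed
  moreover have False if "a < b" "(a, c1) \<in> M" "(b, c) \<in> M" "c < c1" for a b c c1
    using mono[of a b c1 c] that by simp
  ultimately show ?thesis unfolding fan_def using assms(1-4) by blast
qed

text \<open>Start of the induction on the density: each of the \<open>t\<close> columns gets
  \<open>m\<close> rows of its own, and all columns are special.\<close>

lemma fan_columns:
  assumes "m \<ge> 1"
  shows "\<exists>M S. fan m M S \<and> card S = t \<and> card M = m * t \<and> card (fst ` M) = m * t \<and> card (snd ` M) \<le> t"
proof -
  let ?M = "(\<lambda>r. (r, r div m)) ` {..<t * m}" and ?S = "{..<t}"
  have inj: "inj_on (\<lambda>r. (r, r div m)) {..<t * m}" by (auto simp: inj_on_def)
  have fib: "{r. (r, c) \<in> ?M} = {c * m..<c * m + m}" if "c \<in> ?S" for c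
  proof -
    have "r < t * m \<and> r div m = c \<longleftrightarrow> c * m \<le> r \<and> r < c * m + m" for r
    proof
      assume "r < t * m \<and> r div m = c"
      then show "c * m \<le> r \<and> r < c * m + m"
        using assms by (metis div_less_iff_less_mult div_times_less_eq_dividend lessI less_eq_Suc_le
            mult_Suc add.commute not_less_eq_eq One_nat_def)
    next
      assume r: "c * m \<le> r \<and> r < c * m + m"
      then have "r div m = c"
        using assms by (intro div_nat_eqI) (auto simp: mult.commute)
      moreover have "c * m + m \<le> t * m"
        using that by (metis Suc_leI add.commute lessThan_iff mult_Suc mult_le_mono1)
      ultimately show "r < t * m \<and> r div m = c" using r by simp
    qed
    moreover have "{r. (r, c) \<in> ?M} = {r. r < t * m \<and> r div m = c}" by auto
    ultimately show ?thesis by (simp add: set_eq_iff)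
  qed
  have "fan m ?M ?S"
  proof (rule fan_monotone)
    show "card {r. (r, c) \<in> ?M} = m" if "c \<in> ?S" for c using fib[OF that] by simp
  qed (auto simp: div_le_mono)
  moreover have "snd ` ?M \<subseteq> {..<t}"
    using assms by (auto simp: less_mult_imp_div_less)
  then have "card (snd ` ?M) \<le> t" using card_mono[of "{..<t}"] by fastforce
  moreover have "fst ` ?M = {..<t * m}" by (simp add: image_image)
  ultimately show ?thesis
    using card_image[OF inj] by (intro exI[of _ ?M] exI[of _ ?S]) (auto simp: mult.commute)
qed

text \<open>Start of the induction on \<open>m\<close>: each of the \<open>t\<close> rows gets a
  block of \<open>d\<close> columns of its own, whose first column is special.\<close>

lemma fan_rows:
  assumes "d \<ge> 1"
  shows "\<exists>M S. fan 1 M S \<and> card S = t \<and> card M = d * t \<and> card (fst ` M) \<le> t \<and> card (snd ` M) \<le> d * t"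
proof -
  let ?M = "(\<lambda>c. (c div d, c)) ` {..<t * d}" and ?S = "(\<lambda>i. i * d) ` {..<t}"
  have inj: "inj_on (\<lambda>c. (c div d, c)) {..<t * d}" by (auto simp: inj_on_def)
  have "fan 1 ?M ?S"
  proof (rule fan_monotone)
    show "card {r. (r, c) \<in> ?M} = 1" if "c \<in> ?S" for c
    proof -
      have "{r. (r, c) \<in> ?M} = {c div d}" using that assms by auto
      then show ?thesis by simp
    qed
    show "c \<le> c'" if "c \<in> ?S" "(r, c) \<in> ?M" "(r, c') \<in> ?M" for r c c'
      using that assms by (auto simp: div_times_less_eq_dividend)
    show "c \<le> c'" if "a < b" "(a, c) \<in> ?M" "(b, c') \<in> ?M" for a b c c'
      using that by (auto, metis div_le_mono leD nat_le_linear)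
  qed auto
  moreover have "fst ` ?M \<subseteq> {..<t}"
    using assms by (auto simp: less_mult_imp_div_less)
  then have "card (fst ` ?M) \<le> t" using card_mono[of "{..<t}"] by fastforce
  moreover have "snd ` ?M = {..<t * d}" by (simp add: image_image)
  moreover have "card ?S = t" using assms by (subst card_image) (auto simp: inj_on_def)
  ultimately show ?thesis
    using card_image[OF inj] by (intro exI[of _ ?M] exI[of _ ?S]) (auto simp: mult.commute)
qed

text \<open>The largest element of \<open>B\<close> takes the least element of \<open>S\<close>. In
  \<open>fan_compose\<close> this reversal ensures that rows \<open>a < b\<close> of
  \<open>A\<close> occur in this order inside one block only if \<open>b\<close> sits in the old
  column.\<close>

lemma antitone_bij:
  fixes B S :: "nat set"
  assumes "finite B" "finite S" "card B = card S"
  shows "\<exists>h. h ` B \<subseteq> S \<and> (\<forall>a\<in>B. \<forall>b\<in>B. a < b \<longrightarrow> h b < h a)"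
  using assms
proof (induction B arbitrary: S rule: finite_linorder_max_induct)
  case (insert b B)
  then have "S \<noteq> {}" by auto
  let ?s = "Min S"
  have s: "?s \<in> S" "\<And>x. x \<in> S - {?s} \<Longrightarrow> ?s < x"
    using insert.prems \<open>S \<noteq> {}\<close> by (auto simp: order_less_le)
  have "b \<notin> B" using insert.hyps by blast
  with insert have "card B = card (S - {?s})" using s by simp
  with insert.IH[of "S - {?s}"] insert.prems obtain h where
    h: "h ` B \<subseteq> S - {?s}" "\<forall>a\<in>B. \<forall>b\<in>B. a < b \<longrightarrow> h b < h a" by auto
  show ?case
  proof (intro exI[of _ "h(b := ?s)"] conjI)
    show "(h(b := ?s)) ` insert b B \<subseteq> S" using h(1) s(1) by auto
    show "\<forall>x\<in>insert b B. \<forall>y\<in>insert b B. x < y \<longrightarrow> (h(b := ?s)) y < (h(b := ?s)) x"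
    proof (intro ballI impI)
      fix x y assume *: "x \<in> insert b B" "y \<in> insert b B" "x < y"
      then have "x \<in> B" "x \<noteq> b" using insert.hyps by auto
      then show "(h(b := ?s)) y < (h(b := ?s)) x"
        using * h s(2)[of "h x"] by (cases "y = b") auto
    qed
  qed
qed auto

lemma less_div_mod_cases:
  fixes x y :: nat
  assumes "x < y"
  obtains "x div D < y div D" | "x div D = y div D" "x mod D < y mod D"
proof (cases "x div D = y div D")
  case True
  then have "x mod D < y mod D"
    using assms div_mult_mod_eq[of x D] div_mult_mod_eq[of y D] by (metis nat_add_left_cancel_less)
  with True that show ?thesis by blast
next
  case False
  then show ?thesis using assms that div_le_mono[of x y D] by (simp add: order_less_le)
qed

text \<open>
  This is the recursive step of the classical construction of Davenport--Schinzel sequences of order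
  three. In front of each column \<open>y \<in> T\<close> of \<open>A\<close>, put a copy of \<open>B\<close> on new rows below all rows of \<open>A\<close>,
  and give each of the \<open>f\<close> rows starting in \<open>y\<close> a new first occurrence in one of the \<open>f\<close> special
  columns of that copy, lower rows first. Each column \<open>y\<close> of \<open>A\<close> and its copy of \<open>B\<close> occupy the columns
  \<open>y * D + z\<close>, with \<open>z < K\<close> for the copy and \<open>z = K\<close> for the old column.
\<close>

lemma fan_compose:
  assumes A: "fan f A T" and B: "fan m B S" and f: "card S = f" and m: "m \<ge> 1"
  shows "\<exists>M U. fan (Suc m) M U \<and> card U = card T * f \<and>
    card A + card T * card B + card T * f \<le> card M \<and>
    card (fst ` M) \<le> card (fst ` A) + card T * card (fst ` B) \<and>
    card (snd ` M) \<le> card (snd ` A) + card T * card (snd ` B)"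
proof -
  note fin = fan_finite[OF A] fan_finite[OF B]
  have "\<exists>h. h ` {r. (r, y) \<in> A} \<subseteq> S \<and>
      (\<forall>a\<in>{r. (r, y) \<in> A}. \<forall>b\<in>{r. (r, y) \<in> A}. a < b \<longrightarrow> h b < h a)" if "y \<in> T" for y
  proof (rule antitone_bij)
    show "finite {r. (r, y) \<in> A}"
      using finite_imageI[OF fin(1), of fst] by (rule rev_finite_subset) force
    show "card {r. (r, y) \<in> A} = card S" using fan_card[OF A that] f by simp
  qed (use fin in auto)
  then obtain h where h: "\<And>y r. \<lbrakk>y \<in> T; (r, y) \<in> A\<rbrakk> \<Longrightarrow> h y r \<in> S"
    and h_less: "\<And>y a b. \<lbrakk>y \<in> T; (a, y) \<in> A; (b, y) \<in> A; a < b\<rbrakk> \<Longrightarrow> h y b < h y a"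
    by (simp add: image_subset_iff) metis
  have h_inj: "a = b" if "y \<in> T" "(a, y) \<in> A" "(b, y) \<in> A" "h y a = h y b" for y a b
    using h_less[of y a b] h_less[of y b a] that by (metis less_irrefl linorder_neqE_nat)
  have h_onto: "\<exists>r. (r, y) \<in> A \<and> h y r = z" if "y \<in> T" "z \<in> S" for y z
  proof -
    have "inj_on (h y) {r. (r, y) \<in> A}" using h_inj[OF that(1)] by (auto simp: inj_on_def)
    then have "card (h y ` {r. (r, y) \<in> A}) = card S"
      using fan_card[OF A that(1)] f by (simp add: card_image)
    moreover have "h y ` {r. (r, y) \<in> A} \<subseteq> S" using h that by auto
    ultimately have "h y ` {r. (r, y) \<in> A} = S" using fin by (simp add: card_subset_eq)
    then show ?thesis using that by blast
  qed
  have S_sub: "S \<subseteq> snd ` B"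
  proof
    fix z assume "z \<in> S"
    then have "{r. (r, z) \<in> B} \<noteq> {}" using fan_card[OF B] m by force
    then show "z \<in> snd ` B" by force
  qed
  obtain R where R: "\<And>r y. (r, y) \<in> A \<Longrightarrow> r < R"
    using finite_nat_set_iff_bounded[of "fst ` A"] fin by force
  obtain L where L: "\<And>r z. (r, z) \<in> B \<Longrightarrow> r < L"
    using finite_nat_set_iff_bounded[of "fst ` B"] fin by force
  obtain K where K: "\<And>r z. (r, z) \<in> B \<Longrightarrow> z < K"
    using finite_nat_set_iff_bounded[of "snd ` B"] fin by force
  define D where "D = Suc K"
  have S_K: "z < K" if "z \<in> S" for z using that S_sub K by auto
  have dm [simp]: "(y * D + z) div D = y" "(y * D + z) mod D = z" "z mod D = z" if "z \<le> K" for y z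
  proof -
    have "z < D" using that by (simp add: D_def)
    then show "(y * D + z) div D = y" "(y * D + z) mod D = z" "z mod D = z" by auto
  qed
  have dL [simp]: "(y * L + r) div L = y" "(y * L + r) mod L = r" if "r < L" for y r
    using that by auto
  define old where "old = (\<lambda>(r :: nat, y). (r, y * D + K))"
  define new where "new = (\<lambda>(r, y). (r, y * D + h y r))"
  define copy where "copy = (\<lambda>(y, r, z). (R + (y * L + r), y * D + z))"
  define A' where "A' = {(r, y). (r, y) \<in> A \<and> y \<in> T}"
  define M where "M = old ` A \<union> new ` A' \<union> copy ` (T \<times> B)"
  define U where "U = (\<lambda>(y, z). y * D + z) ` (T \<times> S)"
  have finA': "finite A'" using fin(1) by (rule rev_finite_subset) (auto simp: A'_def)
  have finM: "finite M" unfolding M_def using fin finA' by auto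
  \<comment> \<open>Decoding of an entry: a row number less than \<open>R\<close> belongs to
    \<open>A\<close>, and the entry is in the old column or is a new first occurrence; any other row
    belongs to a copy and therefore meets a single block.\<close>
  have mem: "\<rho> < R \<and> (\<rho>, \<gamma> div D) \<in> A \<and>
        (\<gamma> mod D = K \<or> \<gamma> div D \<in> T \<and> \<gamma> mod D = h (\<gamma> div D) \<rho>) \<or>
      R \<le> \<rho> \<and> \<gamma> div D \<in> T \<and> (\<rho> - R) div L = \<gamma> div D \<and> ((\<rho> - R) mod L, \<gamma> mod D) \<in> B"
    if M: "(\<rho>, \<gamma>) \<in> M" for \<rho> \<gamma>
  proof -
    consider r y where "(r, y) \<in> A" "\<rho> = r" "\<gamma> = y * D + K"
      | r y where "(r, y) \<in> A" "y \<in> T" "\<rho> = r" "\<gamma> = y * D + h y r"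
      | r y z where "y \<in> T" "(r, z) \<in> B" "\<rho> = R + (y * L + r)" "\<gamma> = y * D + z"
      using M unfolding M_def A'_def old_def new_def copy_def by auto
    then show ?thesis
    proof cases
      case 1 then show ?thesis using R[of r y] by simp
    next
      case 2 then show ?thesis using R[of r y] S_K[OF h[of y r]] by simp
    next
      case 3 then show ?thesis using L[of r z] K[of r z] by simp
    qed
  qed
  have memU: "\<gamma> div D \<in> T \<and> \<gamma> mod D \<in> S" if "\<gamma> \<in> U" for \<gamma>
    using that S_K unfolding U_def by (auto simp: less_imp_le)
  have starD: "(\<rho>, \<gamma> div D) \<in> A"
    "\<gamma> mod D = K \<or> \<gamma> div D \<in> T \<and> \<gamma> mod D = h (\<gamma> div D) \<rho>" if "(\<rho>, \<gamma>) \<in> M" "\<rho> < R" for \<rho> \<gamma>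
    using mem[OF that(1)] that(2) by auto
  have copyD: "\<gamma> div D \<in> T" "(\<rho> - R) div L = \<gamma> div D" "((\<rho> - R) mod L, \<gamma> mod D) \<in> B"
    if "(\<rho>, \<gamma>) \<in> M" "\<not> \<rho> < R" for \<rho> \<gamma>
    using mem[OF that(1)] that(2) by auto
  have star_U: "\<gamma> mod D = h (\<gamma> div D) \<rho>" if "(\<rho>, \<gamma>) \<in> M" "\<rho> < R" "\<gamma> \<in> U" for \<rho> \<gamma>
    using starD(2)[OF that(1,2)] memU[OF that(3)] S_K by auto
  have first: "\<gamma> \<le> \<gamma>'" if "\<gamma> \<in> U" "(\<rho>, \<gamma>) \<in> M" "(\<rho>, \<gamma>') \<in> M" for \<rho> \<gamma> \<gamma>'
  proof (rule ccontr)
    assume "\<not> \<gamma> \<le> \<gamma>'"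
    then have "\<gamma>' < \<gamma>" by simp
    show False
    proof (cases "\<rho> < R")
      case True
      have "\<gamma> div D \<le> \<gamma>' div D"
        using fan_first[OF A] memU[OF that(1)] starD(1)[OF that(2) True] starD(1)[OF that(3) True]
        by blast
      with \<open>\<gamma>' < \<gamma>\<close> have eq: "\<gamma>' div D = \<gamma> div D" "\<gamma>' mod D < \<gamma> mod D"
        by (auto elim: less_div_mod_cases[of _ _ D])
      with starD(2)[OF that(3) True] star_U[OF that(2) True that(1)]
        S_K[of "\<gamma> mod D"] memU[OF that(1)] show False by auto
    next
      case False
      note c = copyD[OF that(2) False] and c' = copyD[OF that(3) False]
      from c c' \<open>\<gamma>' < \<gamma>\<close> have "\<gamma>' mod D < \<gamma> mod D"
        by (auto elim: less_div_mod_cases[of _ _ D])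
      with fan_first[OF B _ c(3) c'(3)] memU[OF that(1)] show False by simp
    qed
  qed
  \<comment> \<open>Two rows of \<open>A\<close> never share a special column, as \<open>h y\<close>
    is injective on them. If \<open>b\<close> is a row of a copy, all three columns lie in one
    block: a row \<open>a\<close> of \<open>A\<close> would have its entry in \<open>c1\<close> in
    the last column of the block, leaving no room for \<open>c2\<close>, and two rows of the copy
    inherit the property from \<open>B\<close>.\<close>
  have after: False
    if ab: "a < b" and c: "c \<in> U" and ac: "(a, c) \<in> M" and bc: "(b, c) \<in> M"
      and less: "c < c1" "c1 < c2" and ac1: "(a, c1) \<in> M" and bc2: "(b, c2) \<in> M" for a b c c1 c2
  proof (cases "b < R")
    case True
    with ab have aR: "a < R" by simp
    have "h (c div D) a = h (c div D) b"
      using star_U[OF ac aR c] star_U[OF bc True c] by simp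
    with h_inj[of "c div D" a b] memU[OF c] starD(1)[OF ac aR] starD(1)[OF bc True] ab
    show False by simp
  next
    case b: False
    note b1 = copyD[OF bc b] and b2 = copyD[OF bc2 b]
    then have y2: "c2 div D = c div D" by simp
    then have y1: "c1 div D = c div D"
      using less div_le_mono[of c c1 D] div_le_mono[of c1 c2 D] by simp
    have m: "c mod D < c1 mod D" "c1 mod D < c2 mod D"
      using less y1 y2 by (auto elim: less_div_mod_cases[of _ _ D])
    show False
    proof (cases "a < R")
      case True
      have "c2 mod D < K" using b2(3) K by blast
      with starD(2)[OF ac1 True] star_U[OF ac True c] m y1 show False by auto
    next
      case False
      note a1 = copyD[OF ac False] and a2 = copyD[OF ac1 False]
      have "a - R < b - R" using ab False by simp
      then have "(a - R) mod L < (b - R) mod L"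
        by (rule less_div_mod_cases[where D = L]) (use a1(2) b1(2) in auto)
      then show False
        using fan_after[OF B _ _ a1(3) b1(3) m a2(3) b2(3)] memU[OF c] by blast
    qed
  qed
  have free: False
    if ab: "a < b" and less: "c1 < c2" "c2 < c3" "c3 < c4"
      and M: "(a, c1) \<in> M" "(b, c2) \<in> M" "(a, c3) \<in> M" "(b, c4) \<in> M" for a b c1 c2 c3 c4
  proof (cases "b < R")
    case b: True
    with ab have a: "a < R" by simp
    note s = starD(1)[OF M(1) a] starD(1)[OF M(2) b] starD(1)[OF M(3) a] starD(1)[OF M(4) b]
    note z = starD(2)[OF M(1) a] starD(2)[OF M(2) b] starD(2)[OF M(3) a] starD(2)[OF M(4) b]
    note le = div_le_mono[OF less_imp_le[OF less(1)], of D] div_le_mono[OF less_imp_le[OF less(2)], of D]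
      div_le_mono[OF less_imp_le[OF less(3)], of D]
    \<comment> \<open>Both rows start in \<open>y\<close>. The reversal forces \<open>c2\<close>
      into the old column, so \<open>c3\<close> and \<open>c4\<close> lie in later blocks, which
      turn out to be distinct; this contradicts the last clause of \<open>fan\<close> for
      \<open>A\<close>.\<close>
    have strict: False if "y \<in> T" "(a, y) \<in> A" "(b, y) \<in> A"
        and eq1: "c1 div D = y" "c2 div D = y" for y
    proof -
      have "h y b < h y a" using h_less[OF that(1-3) ab] .
      moreover have "h y a < K" using S_K h that by blast
      moreover have "c1 mod D < c2 mod D"
        using less(1) eq1 by (auto elim: less_div_mod_cases[of _ _ D])
      ultimately have "c2 mod D = K" using z(1,2) eq1 by auto
      moreover have "c3 mod D \<le> K" "c4 mod D \<le> K" by (auto simp: D_def less_Suc_eq_le[symmetric])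
      ultimately have y3: "y < c3 div D"
        using less(2) eq1 le(2) by (auto elim: less_div_mod_cases[of _ _ D])
      have y34: "c3 div D < c4 div D"
      proof (rule ccontr)
        assume "\<not> c3 div D < c4 div D"
        then have "c3 div D = c4 div D" "c3 mod D < c4 mod D"
          using less(3) by (auto elim: less_div_mod_cases[of _ _ D])
        with \<open>c4 mod D \<le> K\<close> z(3) have "c3 div D \<in> T" by auto
        from fan_first[OF A this s(3) that(2)] y3 show False by simp
      qed
      show False using fan_after[OF A ab that(1-3) y3 y34 s(3,4)] .
    qed
    \<comment> \<open>An entry of a row of \<open>A\<close> outside the last column of its block is
      a new first occurrence, and these exist only in blocks of \<open>T\<close>.\<close>
    have T: "x div D \<in> T" if "x div D = y div D" "x < y" "(r, x) \<in> M" "r < R" for x y r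
    proof -
      have "x mod D < y mod D" using that(1,2) by (auto elim: less_div_mod_cases[of _ _ D])
      moreover have "y mod D \<le> K" by (auto simp: D_def less_Suc_eq_le[symmetric])
      ultimately show ?thesis using starD(2)[OF that(3,4)] by auto
    qed
    \<comment> \<open>If \<open>c2\<close>, \<open>c3\<close> or \<open>c3\<close>,
      \<open>c4\<close> share a block, then \<open>a\<close> would start in that block, yet
      \<open>c1\<close> lies in an earlier one. Four distinct blocks give \<open>abab\<close> in
      \<open>A\<close>.\<close>
    consider "c1 div D = c2 div D" | "c1 div D \<noteq> c2 div D" "c2 div D = c3 div D"
      | "c1 div D \<noteq> c2 div D" "c3 div D = c4 div D" 
      | "c1 div D < c2 div D" "c2 div D < c3 div D" "c3 div D < c4 div D"
      using le unfolding order_less_le by blast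
    then show False
    proof cases
      case 1
      have "(b, c1 div D) \<in> A" using s(2) by (simp only: 1)
      then show False
        by (rule strict[OF T[OF 1 less(1) M(1) a] s(1) _ refl 1[symmetric]])
    next
      case 2
      have "c2 div D \<in> T" using T[OF 2(2) less(2) M(2) b] .
      moreover have "(a, c2 div D) \<in> A" using s(3) by (simp only: 2(2))
      ultimately have "c2 div D \<le> c1 div D" using fan_first[OF A _ _ s(1)] by blast
      with 2(1) le(1) show False by simp
    next
      case 3
      have "c3 div D \<in> T" using T[OF 3(2) less(3) M(3) a] .
      then have "c3 div D \<le> c1 div D" using fan_first[OF A _ s(3) s(1)] by blast
      with 3(1) le show False by simp
    next
      case 4
      then show False using abab_freeD[OF fan_free[OF A] ab 4 s] by blast
    qed
  next
    case b: False
    note b2 = copyD[OF M(2) b] and b4 = copyD[OF M(4) b]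
    then have y4: "c4 div D = c2 div D" by simp
    then have y3: "c3 div D = c2 div D"
      using less div_le_mono[of c2 c3 D] div_le_mono[of c3 c4 D] by simp
    have m: "c2 mod D < c3 mod D" "c3 mod D < c4 mod D"
      using less y3 y4 by (auto elim: less_div_mod_cases[of _ _ D])
    show False
    proof (cases "a < R")
      \<comment> \<open>Here \<open>c3\<close> precedes an entry of the copy in the same block, so
        it is the first occurrence of \<open>a\<close>, contradicting
        \<open>c1 < c3\<close>.\<close>
      case True
      have "c4 mod D < K" using b4(3) K by blast
      then have c3: "c3 div D \<in> T" "c3 mod D = h (c3 div D) a"
        using starD(2)[OF M(3) True] m y3 by auto
      have "(c3 div D, c3 mod D) \<in> T \<times> S"
        using c3(1) h[OF c3(1) starD(1)[OF M(3) True]] by (simp add: c3(2))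
      moreover have "c3 = (\<lambda>(y, z). y * D + z) (c3 div D, c3 mod D)"
        by (simp only: prod.case div_mult_mod_eq)
      ultimately have "c3 \<in> U" unfolding U_def by (rule rev_image_eqI)
      from first[OF this M(3) M(1)] less show False by simp
    next
      case False
      note a1 = copyD[OF M(1) False] and a3 = copyD[OF M(3) False]
      have y1: "c1 div D = c2 div D" using a1 a3 y3 by simp
      then have m1: "c1 mod D < c2 mod D"
        using less by (auto elim: less_div_mod_cases[of _ _ D])
      have "a - R < b - R" using ab False by simp
      then have "(a - R) mod L < (b - R) mod L"
        by (rule less_div_mod_cases[where D = L]) (use a1(2) b2(2) y1 in auto)
      then show False
        using abab_freeD[OF fan_free[OF B] _ m1 m a1(3) b2(3) a3(3) b4(3)] by blast
    qed
  qed
  have colcard: "card {\<rho>. (\<rho>, \<gamma>) \<in> M} = Suc m" if U: "\<gamma> \<in> U" for \<gamma>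
  proof -
    obtain y z where yz: "y \<in> T" "z \<in> S" "\<gamma> = y * D + z" using U unfolding U_def by auto
    obtain a where a: "(a, y) \<in> A" "h y a = z" using h_onto yz by blast
    let ?C = "(\<lambda>r. R + (y * L + r)) ` {r. (r, z) \<in> B}"
    have "{\<rho>. (\<rho>, \<gamma>) \<in> M} = insert a ?C"
    proof (intro equalityI subsetI)
      fix \<rho> assume "\<rho> \<in> {\<rho>. (\<rho>, \<gamma>) \<in> M}"
      then have \<rho>: "(\<rho>, \<gamma>) \<in> M" by simp
      have dmz: "\<gamma> div D = y" "\<gamma> mod D = z" using yz S_K[of z] by auto
      show "\<rho> \<in> insert a ?C"
      proof (cases "\<rho> < R")
        case True
        then show ?thesis
          using star_U[OF \<rho> True that] starD(1)[OF \<rho> True] dmz h_inj[of y \<rho> a] yz a by auto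
      next
        case False
        note c = copyD[OF \<rho> False]
        have "\<rho> = R + (y * L + (\<rho> - R) mod L)"
          using c(2) dmz False div_mult_mod_eq[of "\<rho> - R" L] by simp
        moreover have "((\<rho> - R) mod L, z) \<in> B" using c(3) dmz by simp
        ultimately show ?thesis by blast
      qed
    next
      fix \<rho> assume "\<rho> \<in> insert a ?C"
      then consider "\<rho> = a" | r where "\<rho> = R + (y * L + r)" "(r, z) \<in> B" by blast
      then show "\<rho> \<in> {\<rho>. (\<rho>, \<gamma>) \<in> M}"
      proof cases
        case 1
        have "(a, y) \<in> A'" using a yz by (simp add: A'_def)
        from imageI[OF this, of new] show ?thesis
          using 1 a yz by (simp add: M_def new_def)
      next
        case 2
        then have "(y, r, z) \<in> T \<times> B" using yz by simp
        from imageI[OF this, of copy] show ?thesis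
          using 2 yz by (simp add: M_def copy_def)
      qed
    qed
    moreover have "a \<notin> ?C" using R[OF a(1)] by auto
    moreover have "finite {r. (r, z) \<in> B}"
      using finite_imageI[OF fin(3), of fst] by (rule rev_finite_subset) force
    moreover have "card ?C = m"
      using fan_card[OF B yz(2)] by (subst card_image) (auto simp: inj_on_def)
    ultimately show ?thesis by simp
  qed
  have "fan (Suc m) M U"
    unfolding fan_def
  proof (intro conjI)
    show "finite U" unfolding U_def using fin by auto
    show "abab_free M" unfolding abab_free_def using free by blast
    show "\<forall>c\<in>U. card {r. (r, c) \<in> M} = Suc m" using colcard by blast
  qed (use finM first after in blast)+
  moreover have "card U = card T * f"
  proof -
    have "inj_on (\<lambda>(y, z). y * D + z) (T \<times> S)"
    proof (rule inj_onI, clarify)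
      fix y z y' z' assume *: "z \<in> S" "z' \<in> S" "y * D + z = y' * D + z'"
      then show "y = y' \<and> z = z'"
        using dm(1,2)[of z y] dm(1,2)[of z' y'] S_K[of z] S_K[of z'] by (metis less_imp_le)
    qed
    then show ?thesis unfolding U_def using f by (simp add: card_image card_cartesian_product)
  qed
  moreover have "card A + card T * card B + card T * f \<le> card M"
  proof -
    have "inj_on old A" unfolding old_def by (auto simp: inj_on_def) (simp add: D_def)
    then have 1: "card (old ` A) = card A" by (rule card_image)
    have "inj_on new A'"
    proof (rule inj_onI)
      fix p q assume pq: "p \<in> A'" "q \<in> A'" "new p = new q"
      obtain r y r' y' where [simp]: "p = (r, y)" "q = (r', y')" by (cases p, cases q)
      have le: "h y r \<le> K" "h y' r' \<le> K"
        using pq h S_K by (auto simp: A'_def less_imp_le)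
      from pq(3) have "r = r'" "y * D + h y r = y' * D + h y' r'" by (auto simp: new_def)
      moreover have "y = y'" using dm(1)[OF le(1), of y] dm(1)[OF le(2), of y'] \<open>y * D + _ = _\<close> by metis
      ultimately show "p = q" by simp
    qed
    moreover have "card A' = card T * f"
    proof -
      have "A' = prod.swap ` (SIGMA y:T. {r. (r, y) \<in> A})" unfolding A'_def by force
      then have "card A' = card (SIGMA y:T. {r. (r, y) \<in> A})" by (simp add: card_image)
      also have "\<dots> = (\<Sum>y\<in>T. card {r. (r, y) \<in> A})"
      proof (rule card_SigmaI)
        show "\<forall>y\<in>T. finite {r. (r, y) \<in> A}"
        proof
          fix y
          show "finite {r. (r, y) \<in> A}"
            using finite_imageI[OF fin(1), of fst] by (rule rev_finite_subset) force
        qed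
      qed (use fin in auto)
      finally show ?thesis using fan_card[OF A] by simp
    qed
    ultimately have 2: "card (new ` A') = card T * f" by (simp add: card_image)
    have "inj_on copy (T \<times> B)"
    proof (rule inj_onI)
      fix p q assume pq: "p \<in> T \<times> B" "q \<in> T \<times> B" "copy p = copy q"
      obtain y r z y' r' z' where [simp]: "p = (y, r, z)" "q = (y', r', z')"
        by (cases p, cases q)
      have "r < L" "r' < L" "z \<le> K" "z' \<le> K" using pq L K by (auto simp: less_imp_le)
      moreover have "y * L + r = y' * L + r'" "y * D + z = y' * D + z'"
        using pq(3) by (auto simp: copy_def)
      ultimately have "y = y' \<and> r = r' \<and> z = z'"
        using dL[of r y] dL[of r' y'] dm(1,2)[of z y] dm(1,2)[of z' y'] by metis
      then show "p = q" by simp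
    qed
    then have 3: "card (copy ` (T \<times> B)) = card T * card B"
      by (simp add: card_image card_cartesian_product)
    have star: "snd p mod D = K \<and> fst p < R" if "p \<in> old ` A" for p
      using that R by (auto simp: old_def)
    have new': "snd p mod D < K \<and> fst p < R" if "p \<in> new ` A'" for p
      using that R S_K h by (force simp: new_def A'_def less_imp_le)
    have copy': "R \<le> fst p" if "p \<in> copy ` (T \<times> B)" for p
      using that by (auto simp: copy_def)
    have "old ` A \<inter> new ` A' = {}" using star new' by fastforce
    moreover have "(old ` A \<union> new ` A') \<inter> copy ` (T \<times> B) = {}"
    proof (rule equals0I)
      fix p assume "p \<in> (old ` A \<union> new ` A') \<inter> copy ` (T \<times> B)"
      then have "fst p < R" "R \<le> fst p" using star[of p] new'[of p] copy'[of p] by blast+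
      then show False by simp
    qed
    ultimately have "card M = card (old ` A) + card (new ` A') + card (copy ` (T \<times> B))"
      unfolding M_def using fin finA' by (simp add: card_Un_disjoint)
    with 1 2 3 show ?thesis by simp
  qed
  moreover have "card (fst ` M) \<le> card (fst ` A) + card T * card (fst ` B)"
  proof -
    have "fst ` M \<subseteq> fst ` A \<union> (\<lambda>(y, r). R + (y * L + r)) ` (T \<times> fst ` B)"
      unfolding M_def old_def new_def copy_def A'_def by force
    then have "card (fst ` M) \<le> card (fst ` A \<union> (\<lambda>(y, r). R + (y * L + r)) ` (T \<times> fst ` B))"
      by (rule card_mono[rotated]) (use fin in auto)
    also have "\<dots> \<le> card (fst ` A) + card ((\<lambda>(y, r). R + (y * L + r)) ` (T \<times> fst ` B))"
      by (rule card_Un_le)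
    also have "card ((\<lambda>(y, r). R + (y * L + r)) ` (T \<times> fst ` B)) \<le> card (T \<times> fst ` B)"
      by (rule card_image_le) (use fin in auto)
    finally show ?thesis by (simp add: card_cartesian_product)
  qed
  moreover have "card (snd ` M) \<le> card (snd ` A) + card T * card (snd ` B)"
  proof -
    have "snd ` M \<subseteq> (\<lambda>y. y * D + K) ` snd ` A \<union> (\<lambda>(y, z). y * D + z) ` (T \<times> snd ` B)"
    proof
      fix x assume "x \<in> snd ` M"
      then consider r y where "(r, y) \<in> A" "x = y * D + K"
        | r y where "(r, y) \<in> A" "y \<in> T" "x = y * D + h y r"
        | r y z where "y \<in> T" "(r, z) \<in> B" "x = y * D + z"
        unfolding M_def A'_def old_def new_def copy_def by auto
      then show "x \<in> (\<lambda>y. y * D + K) ` snd ` A \<union> (\<lambda>(y, z). y * D + z) ` (T \<times> snd ` B)"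
      proof cases
        case 1 then show ?thesis by force
      next
        case 2
        then have "(y, h y r) \<in> T \<times> snd ` B" using h S_sub by blast
        with 2 show ?thesis by force
      next
        case 3
        then have "(y, z) \<in> T \<times> snd ` B" by force
        with 3 show ?thesis by force
      qed
    qed
    then have "card (snd ` M) \<le> card ((\<lambda>y. y * D + K) ` snd ` A \<union> (\<lambda>(y, z). y * D + z) ` (T \<times> snd ` B))"
      by (rule card_mono[rotated]) (use fin in auto)
    also have "\<dots> \<le> card ((\<lambda>y. y * D + K) ` snd ` A) + card ((\<lambda>(y, z). y * D + z) ` (T \<times> snd ` B))"
      by (rule card_Un_le)
    also have "card ((\<lambda>y. y * D + K) ` snd ` A) \<le> card (snd ` A)"
      by (rule card_image_le) (use fin in auto)
    also have "card ((\<lambda>(y, z). y * D + z) ` (T \<times> snd ` B)) \<le> card (T \<times> snd ` B)"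
      by (rule card_image_le) (use fin in auto)
    finally show ?thesis by (simp add: card_cartesian_product)
  qed
  ultimately show ?thesis by blast
qed

text \<open>
  Since \<open>card M \<ge> d * m * card S\<close>, the density is unbounded if \<open>m * card S\<close> bounds the numbers of
  rows and columns. The last clause is the bound \<open>(d + 1 - 1 / m) * card S\<close> on the number of columns;
  the slack \<open>1 / m\<close> absorbs the old columns in the induction on \<open>m\<close>.
\<close>

definition dense_fan :: "nat \<Rightarrow> nat \<Rightarrow> nat \<Rightarrow> bool" where
  "dense_fan d m t \<longleftrightarrow> (\<exists>M S. fan m M S \<and> t \<le> card S \<and> d * m * card S \<le> card M \<and>
     card (fst ` M) \<le> m * card S \<and> m * card (snd ` M) + card S \<le> m * (d + 1) * card S)"

text \<open>\<open>A\<close> is chosen after \<open>B\<close>, since its special columns must have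
  as many rows as \<open>B\<close> has special columns. For each column in \<open>T\<close>, the
  \<open>f\<close> new entries raise the share \<open>d * f\<close> of \<open>A\<close> to
  \<open>Suc d * f\<close>; with \<open>Suc d * m * f\<close> from the copy this makes
  \<open>Suc d * Suc m * f\<close>.\<close>

lemma dense_fan_step:
  assumes m: "m \<ge> 1" and inner: "\<And>t. dense_fan (Suc d) m t" and outer: "\<And>f. f \<ge> 1 \<Longrightarrow> dense_fan d f 1"
  shows "dense_fan (Suc d) (Suc m) t"
proof -
  \<comment> \<open>The surplus \<open>m * (m + 1) * (d + 1)\<close> makes \<open>f\<close> so large
    that the old columns, at most \<open>(d + 1) * s\<close> of them, fit into the slack of the
    column bound.\<close>
  obtain B S where B: "fan m B S" "t + m * (m + 1) * (d + 1) \<le> card S"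
    "Suc d * m * card S \<le> card B" "card (fst ` B) \<le> m * card S"
    "m * card (snd ` B) + card S \<le> m * (Suc d + 1) * card S"
    using inner unfolding dense_fan_def by blast
  define f where "f = card S"
  have f1: "f \<ge> 1" using B(2) m by (auto simp: f_def intro: order_trans[rotated])
  obtain A T where A: "fan f A T" "1 \<le> card T" "d * f * card T \<le> card A"
    "card (fst ` A) \<le> f * card T" "f * card (snd ` A) + card T \<le> f * (d + 1) * card T"
    using outer[OF f1] unfolding dense_fan_def by blast
  define s where "s = card T"
  obtain M U where M: "fan (Suc m) M U" "card U = s * f"
    "card A + s * card B + s * f \<le> card M"
    "card (fst ` M) \<le> card (fst ` A) + s * card (fst ` B)"
    "card (snd ` M) \<le> card (snd ` A) + s * card (snd ` B)"
    using fan_compose[OF A(1) B(1) f_def[symmetric] m] unfolding s_def by blast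
  have "t \<le> card U"
  proof -
    have "t \<le> f" using B(2) by (simp add: f_def)
    also have "\<dots> \<le> s * f" using A(2) by (simp add: s_def)
    finally show ?thesis using M(2) by simp
  qed
  moreover have "Suc d * Suc m * card U \<le> card M"
  proof -
    have "Suc d * Suc m * card U = d * f * s + s * (Suc d * m * f) + s * f"
      by (simp add: M(2) algebra_simps)
    also have "\<dots> \<le> card A + s * card B + s * f"
      using A(3) B(3) by (simp add: s_def f_def add_mono mult_le_mono2)
    finally show ?thesis using M(3) by simp
  qed
  moreover have "card (fst ` M) \<le> Suc m * card U"
  proof -
    have "card (fst ` M) \<le> f * s + s * (m * f)"
      using M(4) A(4) mult_le_mono2[OF B(4), of s] unfolding s_def f_def by linarith
    then show ?thesis by (simp add: M(2) algebra_simps)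
  qed
  moreover have "Suc m * card (snd ` M) + card U \<le> Suc m * (Suc d + 1) * card U"
  proof -
    let ?a = "card (snd ` A)" and ?b = "card (snd ` B)"
    have "f * ?a \<le> f * ((d + 1) * s)" using A(5) unfolding s_def by (metis add_leD1 mult.assoc)
    then have a: "?a \<le> (d + 1) * s" using f1 by (subst (asm) mult_le_cancel1) simp
    have fm: "m * (m + 1) * (d + 1) \<le> f" using B(2) by (simp add: f_def)
    \<comment> \<open>The target is multiplied by \<open>m\<close> to match the bound for
      \<open>B\<close>; the added \<open>s * f\<close> pays for the old columns.\<close>
    have "m * (Suc m * (?a + s * ?b) + s * f) + s * f = m * (m + 1) * ?a + (m + 1) * s * (m * ?b + f)"
      by (simp add: algebra_simps)
    also have "\<dots> \<le> m * (m + 1) * ((d + 1) * s) + (m + 1) * s * (m * (Suc d + 1) * f)"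
      using a B(5) unfolding f_def by (intro add_mono mult_le_mono2)
    also have "m * (m + 1) * ((d + 1) * s) \<le> s * f"
      using mult_le_mono1[OF fm, of s] by (simp add: algebra_simps)
    finally have "m * (Suc m * (?a + s * ?b) + s * f) \<le> (m + 1) * s * (m * (Suc d + 1) * f)"
      by simp
    also have "\<dots> = m * (Suc m * (Suc d + 1) * (s * f))" by (simp add: algebra_simps)
    finally have "Suc m * (?a + s * ?b) + s * f \<le> Suc m * (Suc d + 1) * (s * f)"
      using m by simp
    moreover have "Suc m * card (snd ` M) \<le> Suc m * (?a + s * ?b)"
      using M(5) by (rule mult_le_mono2)
    ultimately show ?thesis unfolding M(2) by linarith
  qed
  ultimately show ?thesis using M(1) unfolding dense_fan_def by blast
qed

text \<open>Double recursion of Ackermann type: the pair \<open>Suc d\<close>, \<open>Suc m\<close>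
  calls \<open>Suc d\<close>, \<open>m\<close> and then \<open>d\<close> with the number of special
  columns just obtained in place of \<open>m\<close>. Hence \<open>m\<close> and \<open>t\<close>
  stay arbitrary in the outer induction.\<close>

lemma dense_fan:
  assumes "d \<ge> 1" "m \<ge> 1"
  shows "dense_fan d m t"
  using assms
proof (induction d arbitrary: m t rule: nat_induct_at_least)
  case (base m t)
  then obtain M S where M: "fan m M S" "card S = t" "card M = m * t" "card (fst ` M) = m * t"
    "card (snd ` M) \<le> t" using fan_columns by blast
  have "m * card (snd ` M) + t \<le> m * t + m * t"
    using M(5) base by (intro add_mono mult_le_mono2) auto
  then show ?case unfolding dense_fan_def using M
    by (intro exI[of _ M] exI[of _ S]) (simp add: add_mult_distrib)
next
  case (Suc d m t)
  from \<open>1 \<le> m\<close> show ?case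
  proof (induction m arbitrary: t rule: nat_induct_at_least)
    case (base t)
    obtain M S where M: "fan 1 M S" "card S = t" "card M = Suc d * t" "card (fst ` M) \<le> t"
      "card (snd ` M) \<le> Suc d * t" using fan_rows[of "Suc d" t] by auto
    then show ?case unfolding dense_fan_def by (intro exI[of _ M] exI[of _ S]) simp
  next
    case (Suc m t)
    then show ?case using dense_fan_step[of m d t] \<open>\<And>m t. 1 \<le> m \<Longrightarrow> dense_fan d m t\<close> by blast
  qed
qed

section \<open>From occupied rows and columns to square matrices\<close>

lemma rank_less:
  fixes X :: "nat set"
  assumes "finite X"
  shows "x \<in> X \<Longrightarrow> card {z \<in> X. z < x} < card X"
    and "card {z \<in> X. z < x} < card {z \<in> X. z < y} \<Longrightarrow> x < y"
    and "x \<in> X \<Longrightarrow> x < y \<Longrightarrow> card {z \<in> X. z < x} < card {z \<in> X. z < y}"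
proof -
  show "card {z \<in> X. z < x} < card X" if "x \<in> X"
    using that assms by (intro psubset_card_mono) auto
  show "x < y" if "card {z \<in> X. z < x} < card {z \<in> X. z < y}"
  proof (rule ccontr)
    assume "\<not> x < y"
    then have "card {z \<in> X. z < y} \<le> card {z \<in> X. z < x}"
      using assms by (intro card_mono) auto
    with that show False by simp
  qed
  show "card {z \<in> X. z < x} < card {z \<in> X. z < y}" if "x \<in> X" "x < y"
    using that assms by (intro psubset_card_mono) auto
qed

text \<open>\<open>dense_fan\<close> counts occupied rows and columns, whereas \<open>ex_num\<close>
  goes by side length. Ranks preserve and reflect the strict order, so an \<open>abab\<close> among
  ranks pulls back to \<open>M\<close>.\<close>

lemma abab_free_compress:
  assumes M: "finite M" "abab_free M"
  shows "\<exists>M'. M' \<subseteq> {..<card (fst ` M)} \<times> {..<card (snd ` M)} \<and> abab_free M' \<and> card M' = card M"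
proof -
  define \<rho> where "\<rho> r = card {z \<in> fst ` M. z < r}" for r
  define \<gamma> where "\<gamma> c = card {z \<in> snd ` M. z < c}" for c
  have fin: "finite (fst ` M)" "finite (snd ` M)" using M by auto
  note R = rank_less[OF fin(1), folded \<rho>_def] and C = rank_less[OF fin(2), folded \<gamma>_def]
  have "inj_on (map_prod \<rho> \<gamma>) M"
  proof (rule inj_onI, clarify)
    fix a b a' b' assume *: "(a, b) \<in> M" "(a', b') \<in> M" "map_prod \<rho> \<gamma> (a, b) = map_prod \<rho> \<gamma> (a', b')"
    then have mem: "a \<in> fst ` M" "a' \<in> fst ` M" "b \<in> snd ` M" "b' \<in> snd ` M" by force+
    show "a = a' \<and> b = b'"
      using *(3) R(3)[OF mem(1), of a'] R(3)[OF mem(2), of a] C(3)[OF mem(3), of b'] C(3)[OF mem(4), of b]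
      by (metis less_irrefl linorder_neqE_nat map_prod_simp prod.inject)
  qed
  then have "card (map_prod \<rho> \<gamma> ` M) = card M" by (rule card_image)
  moreover have "map_prod \<rho> \<gamma> ` M \<subseteq> {..<card (fst ` M)} \<times> {..<card (snd ` M)}"
    using R(1) C(1) by force
  moreover have "abab_free (map_prod \<rho> \<gamma> ` M)"
    unfolding abab_free_def
  proof (intro allI impI)
    fix a b c1 c2 c3 c4 :: nat
    assume less: "a < b" "c1 < c2" "c2 < c3" "c3 < c4"
      and "(a, c1) \<in> map_prod \<rho> \<gamma> ` M" "(b, c2) \<in> map_prod \<rho> \<gamma> ` M"
        "(a, c3) \<in> map_prod \<rho> \<gamma> ` M" "(b, c4) \<in> map_prod \<rho> \<gamma> ` M"
    then obtain r1 k1 r2 k2 r3 k3 r4 k4 where M': "(r1, k1) \<in> M" "(r2, k2) \<in> M" "(r3, k3) \<in> M" "(r4, k4) \<in> M"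
      and eq: "a = \<rho> r1" "b = \<rho> r2" "a = \<rho> r3" "b = \<rho> r4" "c1 = \<gamma> k1" "c2 = \<gamma> k2" "c3 = \<gamma> k3" "c4 = \<gamma> k4"
      by auto
    have mem: "r1 \<in> fst ` M" "r2 \<in> fst ` M" "r3 \<in> fst ` M" "r4 \<in> fst ` M" using M' by force+
    have "r1 = r3" "r2 = r4"
      using R(3)[OF mem(1), of r3] R(3)[OF mem(3), of r1] R(3)[OF mem(2), of r4] R(3)[OF mem(4), of r2] eq
      by (metis less_irrefl linorder_neqE_nat)+
    moreover have "r1 < r2" "k1 < k2" "k2 < k3" "k3 < k4"
      using less R(2) C(2) unfolding eq by (metis eq)+
    ultimately show False using abab_freeD[OF M(2)] M' by blast
  qed
  ultimately show ?thesis by blast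
qed

lemma abab_free_superlinear:
  "\<exists>n\<ge>t. \<exists>M. M \<subseteq> {..<n} \<times> {..<n} \<and> abab_free M \<and> C * n \<le> card M"
proof -
  define d where "d = Suc C"
  \<comment> \<open>With \<open>m = d + 1\<close> the row bound \<open>m * card S\<close> and the
    column bound \<open>(d + 1) * card S\<close> coincide; this value is the side length
    \<open>n\<close>, and there are at least \<open>d * n\<close> entries.\<close>
  obtain M S where M: "fan (d + 1) M S" "t \<le> card S" "d * (d + 1) * card S \<le> card M"
    "card (fst ` M) \<le> (d + 1) * card S" "(d + 1) * card (snd ` M) + card S \<le> (d + 1) * (d + 1) * card S"
    using dense_fan[of d "d + 1" t] unfolding dense_fan_def d_def by auto
  define n where "n = (d + 1) * card S"
  have "(d + 1) * card (snd ` M) \<le> (d + 1) * n"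
    using M(5) unfolding n_def by (metis add_leD1 mult.assoc)
  then have "card (snd ` M) \<le> n" by (subst (asm) mult_le_cancel1) simp
  moreover have "card (fst ` M) \<le> n" using M(4) by (simp add: n_def)
  moreover obtain M' where M': "M' \<subseteq> {..<card (fst ` M)} \<times> {..<card (snd ` M)}" "abab_free M'" "card M' = card M"
    using abab_free_compress[OF fan_finite(1)[OF M(1)] fan_free[OF M(1)]] by blast
  ultimately have "M' \<subseteq> {..<n} \<times> {..<n}" by fastforce
  moreover have "C * n \<le> card M'"
  proof -
    have "C * n \<le> d * n" by (simp add: d_def)
    also have "\<dots> \<le> card M" using M(3) unfolding n_def by (simp only: mult.assoc)
    finally show ?thesis using M'(3) by simp
  qed
  moreover have "t \<le> n" using M(2) by (simp add: n_def)
  ultimately show ?thesis using M'(2) by blast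
qed

section \<open>Containment and embeddings\<close>

lemma positions_conv_nth: "x \<in> positions ks \<longleftrightarrow> length x = length ks \<and> (\<forall>i<length ks. x ! i < ks ! i)"
  by (auto simp: positions_def list_all2_conv_all_nth)

lemma snoc_in_positions [simp]: "w @ [z] \<in> positions (ks @ [k]) \<longleftrightarrow> w \<in> positions ks \<and> z < k"
  by (auto simp: positions_conv_nth nth_append less_Suc_eq)

lemma positions_snoc: "x \<in> positions (ks @ [k]) \<longleftrightarrow> (\<exists>w z. x = w @ [z] \<and> w \<in> positions ks \<and> z < k)"
proof (cases x rule: rev_cases)
  case Nil
  then show ?thesis by (simp add: positions_conv_nth)
qed simp

lemma card_positions_replicate: "card (positions (replicate m n)) = n ^ m"
proof -
  have "positions (replicate m n) = {x. set x \<subseteq> {..<n} \<and> length x = m}"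
    unfolding subset_eq lessThan_iff all_set_conv_all_nth by (auto simp: positions_conv_nth)
  then show ?thesis by (simp add: card_lists_length_eq)
qed

section \<open>Containment through strictly increasing coordinate maps\<close>

definition strict_emb :: "nat \<Rightarrow> nat \<Rightarrow> (nat \<Rightarrow> nat) \<Rightarrow> bool" where
  "strict_emb k n g \<longleftrightarrow> strict_mono_on {..<k} g \<and> g ` {..<k} \<subseteq> {..<n}"

lemma strict_embI:
  "\<lbrakk>\<And>i j. \<lbrakk>i < j; j < k\<rbrakk> \<Longrightarrow> g i < g j; \<And>i. i < k \<Longrightarrow> g i < n\<rbrakk> \<Longrightarrow> strict_emb k n g"
  by (auto simp: strict_emb_def intro!: strict_mono_onI)

lemma strict_emb_less: "\<lbrakk>strict_emb k n g; i < j; j < k\<rbrakk> \<Longrightarrow> g i < g j"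
  by (auto simp: strict_emb_def strict_mono_on_def)

lemma strict_emb_bound: "\<lbrakk>strict_emb k n g; i < k\<rbrakk> \<Longrightarrow> g i < n"
  by (auto simp: strict_emb_def)

lemma strict_emb_le: "\<lbrakk>strict_emb k n g; i \<le> j; j < k\<rbrakk> \<Longrightarrow> g i \<le> g j"
  using strict_emb_less by (cases "i = j") (auto simp: less_imp_le)

definition emb :: "(nat \<Rightarrow> nat \<Rightarrow> nat) \<Rightarrow> nat list \<Rightarrow> nat list" where
  "emb \<phi> x = map (\<lambda>i. \<phi> i (x ! i)) [0..<length x]"

lemma emb_snoc: "emb \<phi> (w @ [z]) = emb \<phi> w @ [\<phi> (length w) z]"
  by (simp add: emb_def nth_append)

lemma nth_emb: "i < length x \<Longrightarrow> emb \<phi> x ! i = \<phi> i (x ! i)"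
  by (simp add: emb_def)

lemma emb_cong: "(\<And>i. i < length x \<Longrightarrow> \<phi> i = \<psi> i) \<Longrightarrow> emb \<phi> x = emb \<psi> x"
  by (simp add: emb_def)

lemma sorted_list_of_set_strict_emb:
  assumes "strict_emb k n g" "j < k"
  shows "card (g ` {..<k}) = k" "sorted_list_of_set (g ` {..<k}) ! j = g j"
proof -
  have sm: "strict_mono_on {..<k} g" using assms by (simp add: strict_emb_def)
  then show card: "card (g ` {..<k}) = k"
    using card_image[OF strict_mono_on_imp_inj_on] by fastforce
  have "sorted_wrt (<) (map g [0..<k])"
    unfolding sorted_wrt_map by (rule sorted_wrt_mono_rel[of _ "(<)"])
      (use strict_emb_less[OF assms(1)] in auto)
  moreover have "set (map g [0..<k]) = g ` {..<k}" by (auto simp: atLeast0LessThan)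
  ultimately have "sorted_list_of_set (g ` {..<k}) = map g [0..<k]"
    using card by (subst sorted_list_of_set_unique[symmetric]) auto
  then show "sorted_list_of_set (g ` {..<k}) ! j = g j" using assms by simp
qed

lemma strict_emb_sorted_list_of_set:
  assumes "S \<subseteq> {..<n}"
  shows "strict_emb (card S) n ((!) (sorted_list_of_set S))"
proof (rule strict_embI)
  have fin: "finite S" using assms finite_subset by blast
  show "sorted_list_of_set S ! i < sorted_list_of_set S ! j" if "i < j" "j < card S" for i j
    using sorted_wrt_nth_less[OF strict_sorted_list_of_set, of i j S] that fin by simp
  show "sorted_list_of_set S ! i < n" if "i < card S" for i
    using nth_mem[of i "sorted_list_of_set S"] that fin assms by auto
qed

text \<open>An index set corresponds to its increasing enumeration, and an embedding to its image.
  Unlike index sets, embeddings are easily altered at a single index, as the thinning arguments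
  require.\<close>

lemma contains_iff_emb:
  assumes len: "length (dims A) = length (dims P)" and P: "ones P \<subseteq> positions (dims P)"
  shows "contains A P \<longleftrightarrow>
    (\<exists>\<phi>. (\<forall>i<length (dims P). strict_emb (dims P ! i) (dims A ! i) (\<phi> i)) \<and>
         (\<forall>x\<in>ones P. emb \<phi> x \<in> ones A))"
    (is "_ \<longleftrightarrow> ?R")
proof
  assume "contains A P"
  then obtain Ss where Ss: "list_all2 (\<lambda>S n. S \<subseteq> {..<n}) Ss (dims A)"
    "map card Ss = dims P" "ones P \<subseteq> ones (submatrix Ss A)"
    unfolding contains_def by (auto simp: submatrix_def)
  have l: "length Ss = length (dims P)" using Ss(2) length_map by metis
  define \<phi> where "\<phi> i = (!) (sorted_list_of_set (Ss ! i))" for i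
  have "strict_emb (dims P ! i) (dims A ! i) (\<phi> i)" if "i < length (dims P)" for i
  proof -
    have "dims P ! i = card (Ss ! i)" using that l by (metis Ss(2) nth_map)
    moreover have "Ss ! i \<subseteq> {..<dims A ! i}" using Ss(1) that l by (simp add: list_all2_conv_all_nth)
    ultimately show ?thesis using strict_emb_sorted_list_of_set by (simp add: \<phi>_def)
  qed
  moreover have "emb \<phi> x \<in> ones A" if "x \<in> ones P" for x
  proof -
    have "length x = length Ss" using that P l by (auto simp: positions_conv_nth)
    then have "emb \<phi> x = map2 (\<lambda>S i. sorted_list_of_set S ! i) Ss x"
      by (intro nth_equalityI) (auto simp: emb_def \<phi>_def)
    then show ?thesis using that Ss(3) by (auto simp: submatrix_def)
  qed
  ultimately show ?R by blast
next
  assume ?R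
  then obtain \<phi> where \<phi>: "\<And>i. i < length (dims P) \<Longrightarrow> strict_emb (dims P ! i) (dims A ! i) (\<phi> i)"
    "\<And>x. x \<in> ones P \<Longrightarrow> emb \<phi> x \<in> ones A" by blast
  define Ss where "Ss = map (\<lambda>i. \<phi> i ` {..<dims P ! i}) [0..<length (dims P)]"
  have card: "map card Ss = dims P"
  proof (rule nth_equalityI)
    fix i assume "i < length (map card Ss)"
    then have i: "i < length (dims P)" by (simp add: Ss_def)
    then show "map card Ss ! i = dims P ! i"
      using \<phi>(1)[OF i] card_image[OF strict_mono_on_imp_inj_on, of "{..<dims P ! i}" "\<phi> i"]
      by (auto simp: Ss_def strict_emb_def)
  qed (simp add: Ss_def)
  have "list_all2 (\<lambda>S n. S \<subseteq> {..<n}) Ss (dims A)"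
    using \<phi>(1) len by (auto simp: list_all2_conv_all_nth Ss_def strict_emb_def)
  moreover have "ones P \<subseteq> ones (submatrix Ss A)"
  proof
    fix x assume x: "x \<in> ones P"
    then have pos: "x \<in> positions (dims P)" using P by blast
    then have lx: "length x = length (dims P)" by (simp add: positions_conv_nth)
    have "map2 (\<lambda>S i. sorted_list_of_set S ! i) Ss x = emb \<phi> x"
    proof (rule nth_equalityI)
      fix i assume "i < length (map2 (\<lambda>S i. sorted_list_of_set S ! i) Ss x)"
      then have i: "i < length (dims P)" by (simp add: Ss_def)
      then have "x ! i < dims P ! i" using pos by (simp add: positions_conv_nth)
      with sorted_list_of_set_strict_emb(2)[OF \<phi>(1)[OF i] this]
      show "map2 (\<lambda>S i. sorted_list_of_set S ! i) Ss x ! i = emb \<phi> x ! i"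
        using i lx by (simp add: Ss_def emb_def)
    qed (simp add: Ss_def emb_def lx)
    then show "x \<in> ones (submatrix Ss A)" using \<phi>(2)[OF x] pos card by (simp add: submatrix_def)
  qed
  ultimately show "contains A P"
    unfolding contains_def using card by (intro exI[of _ Ss]) (auto simp: submatrix_def)
qed

lemma contains_snoc:
  assumes A: "dims A = ns @ [n]" and P: "dims P = ks @ [k]" "ones P \<subseteq> positions (dims P)"
    and len: "length ns = length ks"
  shows "contains A P \<longleftrightarrow>
    (\<exists>\<phi> g. (\<forall>i<length ks. strict_emb (ks ! i) (ns ! i) (\<phi> i)) \<and> strict_emb k n g \<and>
       (\<forall>w z. w @ [z] \<in> ones P \<longrightarrow> emb \<phi> w @ [g z] \<in> ones A))"
    (is "_ \<longleftrightarrow> ?R")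
proof -
  have 1: "length (dims A) = length (dims P)" using A P len by simp
  have l: "length w = length ks" if "w @ [z] \<in> ones P" for w z
    using that P by (auto simp: positions_conv_nth)
  show ?thesis
    unfolding contains_iff_emb[OF 1 P(2)]
  proof
    assume "\<exists>\<phi>. (\<forall>i<length (dims P). strict_emb (dims P ! i) (dims A ! i) (\<phi> i)) \<and>
         (\<forall>x\<in>ones P. emb \<phi> x \<in> ones A)"
    then obtain \<phi> where \<phi>: "\<And>i. i < Suc (length ks) \<Longrightarrow> strict_emb (dims P ! i) (dims A ! i) (\<phi> i)"
      "\<And>x. x \<in> ones P \<Longrightarrow> emb \<phi> x \<in> ones A" using P(1) by auto
    have "strict_emb (ks ! i) (ns ! i) (\<phi> i)" if "i < length ks" for i
      using \<phi>(1)[of i] that A P(1) len by (simp add: nth_append)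
    moreover have "strict_emb k n (\<phi> (length ks))"
      using \<phi>(1)[of "length ks"] A P(1) len by (simp add: nth_append)
    moreover have "emb \<phi> w @ [\<phi> (length ks) z] \<in> ones A" if "w @ [z] \<in> ones P" for w z
      using \<phi>(2)[OF that] l[OF that] by (simp add: emb_snoc)
    ultimately show ?R by blast
  next
    assume ?R
    then obtain \<phi> g where \<phi>: "\<And>i. i < length ks \<Longrightarrow> strict_emb (ks ! i) (ns ! i) (\<phi> i)"
      and g: "strict_emb k n g" and ones: "\<And>w z. w @ [z] \<in> ones P \<Longrightarrow> emb \<phi> w @ [g z] \<in> ones A"
      by blast
    define \<psi> where "\<psi> = \<phi>(length ks := g)"
    have "strict_emb (dims P ! i) (dims A ! i) (\<psi> i)" if "i < length (dims P)" for i
      using that \<phi> g A P(1) len by (auto simp: \<psi>_def nth_append less_Suc_eq)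
    moreover have "emb \<psi> x \<in> ones A" if px: "x \<in> ones P" for x
    proof -
      obtain w z where x: "x = w @ [z]" using px P by (auto simp: subset_iff positions_snoc)
      with l px have "length w = length ks" by blast
      moreover from this have "emb \<psi> w = emb \<phi> w" by (intro emb_cong) (simp add: \<psi>_def)
      ultimately show ?thesis using ones px by (simp add: x emb_snoc \<psi>_def)
    qed
    ultimately show "\<exists>\<phi>. (\<forall>i<length (dims P). strict_emb (dims P ! i) (dims A ! i) (\<phi> i)) \<and>
         (\<forall>x\<in>ones P. emb \<phi> x \<in> ones A)" by blast
  qed
qed

section \<open>Transfer of upper bounds from one pattern to another\<close>

lemma card_le_ex_num: "A \<in> free_matrices n P d \<Longrightarrow> card (ones A) \<le> ex_num n P d"
  using finite_free_matrices by (auto simp: ex_num_def intro!: Max_ge)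

lemma ex_num_le:
  assumes "\<And>A. A \<in> free_matrices n P d \<Longrightarrow> card (ones A) \<le> B"
  shows "ex_num n P d \<le> B"
  using assms finite_free_matrices by (auto simp: ex_num_def)

lemma not_smallomega_and_bigo_power:
  assumes "f \<in> \<omega>(\<lambda>n. real n ^ e)" "f \<in> O(\<lambda>n. real n ^ e)"
  shows False
proof -
  have "(\<lambda>n. real n ^ e) \<in> o(f)" using assms(1) by (simp add: smallomega_iff_smallo)
  then have "(\<lambda>n. real n ^ e) \<in> o(\<lambda>n. real n ^ e)" using assms(2) by (rule landau_o.small_big_trans)
  then have "eventually (\<lambda>n. real n ^ e = 0) sequentially" by (simp add: landau_o.small_refl_iff)
  then obtain N where "\<And>n. n \<ge> N \<Longrightarrow> real n ^ e = 0" by (auto simp: eventually_sequentially)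
  from this[of "Suc N"] show False by simp
qed

lemma bigo_ex_num_reduce:
  assumes O: "(\<lambda>n. real (ex_num n P' d)) \<in> O(\<lambda>n. real n ^ e)"
    and red: "\<And>n A. \<lbrakk>n \<ge> n0; A \<in> free_matrices n P d\<rbrakk> \<Longrightarrow>
      \<exists>A'\<in>free_matrices n P' d. card (ones A) \<le> C * card (ones A') + C * n ^ e"
  shows "(\<lambda>n. real (ex_num n P d)) \<in> O(\<lambda>n. real n ^ e)"
proof -
  obtain c where c: "eventually (\<lambda>n. norm (real (ex_num n P' d)) \<le> c * norm (real n ^ e)) sequentially"
    using O by (elim landau_o.bigE)
  show ?thesis
  proof (rule bigoI)
    show "eventually (\<lambda>n. norm (real (ex_num n P d)) \<le> (real C * c + real C) * norm (real n ^ e)) sequentially"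
      using c eventually_ge_at_top[of n0]
    proof eventually_elim
      case (elim n)
      have "ex_num n P d \<le> C * ex_num n P' d + C * n ^ e"
      proof (rule ex_num_le)
        fix A assume "A \<in> free_matrices n P d"
        then obtain A' where A': "A' \<in> free_matrices n P' d" "card (ones A) \<le> C * card (ones A') + C * n ^ e"
          using red elim by blast
        have "C * card (ones A') \<le> C * ex_num n P' d" using card_le_ex_num[OF A'(1)] by (rule mult_le_mono2)
        with A'(2) show "card (ones A) \<le> C * ex_num n P' d + C * n ^ e" by linarith
      qed
      then have "real (ex_num n P d) \<le> real C * real (ex_num n P' d) + real C * real n ^ e"
        by (metis of_nat_add of_nat_le_iff of_nat_mult of_nat_power)
      moreover have "real C * real (ex_num n P' d) \<le> real C * (c * real n ^ e)"
        using elim by (intro mult_left_mono) auto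
      ultimately show ?case by (simp add: algebra_simps)
    qed
  qed
qed

text \<open>
  Only the embedding of the last coordinate has to be adapted; the embeddings of the others enter
  through an arbitrary map \<open>F\<close> on the remaining part of a position.
\<close>

lemma bigo_ex_num_last_coordinate:
  assumes P: "zo_matrix (Suc e) P" "dims P = ks @ [k]"
    and P': "zo_matrix (Suc e) P'" "dims P' = ks @ [k']"
    and O: "(\<lambda>n. real (ex_num n P' (Suc e))) \<in> O(\<lambda>n. real n ^ e)"
    and red: "\<And>n A. \<lbrakk>n \<ge> n0; A \<subseteq> positions (replicate e n @ [n])\<rbrakk> \<Longrightarrow>
      \<exists>A'\<subseteq>A. card A \<le> C * card A' + C * n ^ e \<and>
        (\<forall>F g'. strict_emb k' n g' \<longrightarrow> (\<forall>w z. w @ [z] \<in> ones P' \<longrightarrow> F w @ [g' z] \<in> A') \<longrightarrow>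
          (\<exists>g. strict_emb k n g \<and> (\<forall>w z. w @ [z] \<in> ones P \<longrightarrow> F w @ [g z] \<in> A)))"
  shows "(\<lambda>n. real (ex_num n P (Suc e))) \<in> O(\<lambda>n. real n ^ e)"
proof (rule bigo_ex_num_reduce[OF O])
  fix n A assume n: "n \<ge> n0" and "A \<in> free_matrices n P (Suc e)"
  then have A: "zo_matrix (Suc e) A" "dims A = replicate e n @ [n]" "\<not> contains A P"
    by (auto simp: free_matrices_def replicate_append_same)
  then have sub: "ones A \<subseteq> positions (replicate e n @ [n])" by (auto simp: zo_matrix_def)
  from red[OF n this] obtain A' where A': "A' \<subseteq> ones A" "card (ones A) \<le> C * card A' + C * n ^ e"
    and ext: "\<And>F g'. \<lbrakk>strict_emb k' n g'; \<And>w z. w @ [z] \<in> ones P' \<Longrightarrow> F w @ [g' z] \<in> A'\<rbrakk> \<Longrightarrow>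
          \<exists>g. strict_emb k n g \<and> (\<forall>w z. w @ [z] \<in> ones P \<longrightarrow> F w @ [g z] \<in> ones A)"
    by metis
  define B where "B = ZOMat (replicate e n @ [n]) A'"
  have lks: "length ks = e" using P by (auto simp: zo_matrix_def)
  have pos: "ones P \<subseteq> positions (dims P)" "ones P' \<subseteq> positions (dims P')"
    using P P' by (auto simp: zo_matrix_def)
  have "zo_matrix (Suc e) B" using A A' by (auto simp: zo_matrix_def B_def)
  moreover have "\<not> contains B P'"
  proof
    assume "contains B P'"
    then obtain \<phi> g' where \<phi>: "\<And>i. i < length ks \<Longrightarrow> strict_emb (ks ! i) (replicate e n ! i) (\<phi> i)"
      and g': "strict_emb k' n g'" "\<And>w z. w @ [z] \<in> ones P' \<Longrightarrow> emb \<phi> w @ [g' z] \<in> A'"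
      using contains_snoc[of B "replicate e n" n P' ks k'] P' pos lks by (auto simp: B_def)
    from ext[where F = "emb \<phi>", OF g'] obtain g where "strict_emb k n g" "\<And>w z. w @ [z] \<in> ones P \<Longrightarrow> emb \<phi> w @ [g z] \<in> ones A"
      by blast
    with \<phi> have "contains A P"
      using contains_snoc[OF A(2) P(2) pos(1)] lks by auto
    with A(3) show False by contradiction
  qed
  ultimately have "B \<in> free_matrices n P' (Suc e)"
    by (simp add: free_matrices_def B_def replicate_append_same)
  with A'(2) show "\<exists>A'\<in>free_matrices n P' (Suc e). card (ones A) \<le> C * card (ones A') + C * n ^ e"
    by (intro bexI[of _ B]) (auto simp: B_def)
qed

section \<open>Thinning along the last coordinate\<close>

lemma emb_id [simp]: "emb (\<lambda>i j. j) w = w"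
  by (simp add: emb_def map_nth)

lemma strict_emb_id: "strict_emb k k (\<lambda>j. j)"
  by (rule strict_embI)

lemma contains_fewer_ones:
  assumes "ones P \<subseteq> positions (dims P)" "S \<subseteq> ones P"
  shows "contains P (ZOMat (dims P) S)"
  by (subst contains_iff_emb) (use assms strict_emb_id in \<open>auto intro!: exI[of _ "\<lambda>i j. j"]\<close>)

lemma finite_fibre: "A \<subseteq> positions (ks @ [n]) \<Longrightarrow> finite {z. w @ [z] \<in> A}"
  by (rule finite_subset[of _ "{..<n}"]) auto

lemma card_eq_sum_lines:
  assumes "A \<subseteq> positions (ks @ [n])"
  shows "card A = (\<Sum>w\<in>positions ks. card {z. w @ [z] \<in> A})"
proof -
  have "A = (\<lambda>(w, z). w @ [z]) ` (SIGMA w:positions ks. {z. w @ [z] \<in> A})"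
  proof (intro equalityI subsetI)
    fix x assume x: "x \<in> A"
    then have "x \<in> positions (ks @ [n])" using assms by blast
    then obtain w z where "x = w @ [z]" "w \<in> positions ks" by (auto simp: positions_snoc)
    with x show "x \<in> (\<lambda>(w, z). w @ [z]) ` (SIGMA w:positions ks. {z. w @ [z] \<in> A})" by force
  qed auto
  then have "card A = card ((\<lambda>(w, z). w @ [z]) ` (SIGMA w:positions ks. {z. w @ [z] \<in> A}))"
    by simp
  also have "\<dots> = card (SIGMA w:positions ks. {z. w @ [z] \<in> A})"
    by (rule card_image) (auto simp: inj_on_def)
  also have "\<dots> = (\<Sum>w\<in>positions ks. card {z. w @ [z] \<in> A})"
    using finite_fibre[OF assms] by (intro card_SigmaI) (auto simp: finite_positions)
  finally show ?thesis .
qed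

text \<open>Ranks are counted from above, so a new minimum changes no other rank and itself gets the
  old cardinality as its rank.\<close>

lemma card_odd_rank:
  fixes Z :: "nat set"
  assumes "finite Z"
  shows "card {z \<in> Z. odd (card {y \<in> Z. z < y})} = card Z div 2"
  using assms
proof (induction Z rule: finite_linorder_min_induct)
  case (insert b Z)
  have b: "b \<notin> Z" using insert by auto
  have rb: "{y \<in> insert b Z. b < y} = Z" using insert by auto
  have rZ: "{y \<in> insert b Z. z < y} = {y \<in> Z. z < y}" if "z \<in> Z" for z
    using insert that by (auto dest: less_trans)
  have "z \<in> insert b Z \<and> odd (card {y \<in> insert b Z. z < y}) \<longleftrightarrow>
      z = b \<and> odd (card Z) \<or> z \<in> Z \<and> odd (card {y \<in> Z. z < y})" for z
  proof (cases "z = b")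
    case True
    then show ?thesis using b by (simp only: rb) simp
  next
    case False
    then show ?thesis using rZ by (cases "z \<in> Z") simp_all
  qed
  then have "{z \<in> insert b Z. odd (card {y \<in> insert b Z. z < y})} =
      (if odd (card Z) then insert b {z \<in> Z. odd (card {y \<in> Z. z < y})}
       else {z \<in> Z. odd (card {y \<in> Z. z < y})})"
    by (simp add: set_eq_iff)
  then show ?case using insert b by (simp add: card_insert_if)
qed simp

text \<open>
  On each line, keep every second 1-entry, counted from the end so that the last one is dropped.
  A dropped entry is then available for the isolated one.
\<close>

lemma bigo_ex_num_isolated_one:
  assumes P: "zo_matrix (Suc e) P" "dims P = ks @ [k]"
    and c: "v @ [c] \<in> ones P" "\<And>w. w @ [c] \<in> ones P \<Longrightarrow> w = v" "c > 0"
    and nb: "v @ [c - 1] \<in> ones P" "Suc c < k \<Longrightarrow> v @ [Suc c] \<in> ones P"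
    and O: "(\<lambda>n. real (ex_num n (ZOMat (dims P) (ones P - {v @ [c]})) (Suc e))) \<in> O(\<lambda>n. real n ^ e)"
  shows "(\<lambda>n. real (ex_num n P (Suc e))) \<in> O(\<lambda>n. real n ^ e)"
proof (rule bigo_ex_num_last_coordinate[OF P _ _ O])
  show "zo_matrix (Suc e) (ZOMat (dims P) (ones P - {v @ [c]}))"
    using P by (auto simp: zo_matrix_def)
  show "dims (ZOMat (dims P) (ones P - {v @ [c]})) = ks @ [k]" using P by simp
  have ck: "c < k" using P c by (force simp: zo_matrix_def)
  fix n A assume A: "A \<subseteq> positions (replicate e n @ [n])"
  define Z where "Z w = {z. w @ [z] \<in> A}" for w
  have Zfin: "finite (Z w)" for w using finite_fibre[OF A] by (simp add: Z_def)
  define rank where "rank w z = card {y \<in> Z w. z < y}" for w z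
  define A' where "A' = {w @ [z] | w z. w @ [z] \<in> A \<and> odd (rank w z)}"
  have mem: "w @ [z] \<in> A' \<longleftrightarrow> z \<in> Z w \<and> odd (rank w z)" for w z
    by (auto simp: A'_def Z_def)
  have sub: "A' \<subseteq> A" by (auto simp: A'_def)
  have "card A \<le> 2 * card A' + n ^ e"
  proof -
    have "card A = (\<Sum>w\<in>positions (replicate e n). card (Z w))"
      using card_eq_sum_lines[OF A] by (simp add: Z_def)
    also have "\<dots> \<le> (\<Sum>w\<in>positions (replicate e n). 2 * card {z \<in> Z w. odd (rank w z)} + 1)"
    proof (rule sum_mono)
      fix w
      show "card (Z w) \<le> 2 * card {z \<in> Z w. odd (rank w z)} + 1"
        unfolding rank_def card_odd_rank[OF Zfin] by simp
    qed
    also have "\<dots> = 2 * (\<Sum>w\<in>positions (replicate e n). card {z. w @ [z] \<in> A'}) + n ^ e"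
      unfolding sum.distrib sum_distrib_left by (simp add: mem card_positions_replicate)
    also have "(\<Sum>w\<in>positions (replicate e n). card {z. w @ [z] \<in> A'}) = card A'"
      using card_eq_sum_lines[of A' "replicate e n" n] sub A by auto
    finally show ?thesis .
  qed
  moreover have "\<exists>g. strict_emb k n g \<and> (\<forall>w z. w @ [z] \<in> ones P \<longrightarrow> F w @ [g z] \<in> A)"
    if g': "strict_emb k n g'" and F: "\<And>w z. w @ [z] \<in> ones P - {v @ [c]} \<Longrightarrow> F w @ [g' z] \<in> A'" for F g'
  proof -
    have prev: "g' (c - 1) \<in> Z (F v)" "odd (rank (F v) (g' (c - 1)))"
      using F[of v "c - 1"] nb(1) c(3) by (auto simp: mem)
    \<comment> \<open>Consecutive entries of a line have ranks of different parity, so a dropped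
      entry lies between any two kept ones. If \<open>c\<close> is the last layer, it is enough that
      a kept entry has odd, hence positive, rank.\<close>
    have "\<exists>y. y \<in> Z (F v) \<and> g' (c - 1) < y \<and> (Suc c < k \<longrightarrow> y < g' (Suc c))"
    proof (rule ccontr)
      assume no: "\<not> ?thesis"
      show False
      proof (cases "Suc c < k")
        case False
        with no have "{y \<in> Z (F v). g' (c - 1) < y} = {}" by auto
        then have "rank (F v) (g' (c - 1)) = 0" unfolding rank_def by (simp only: card.empty)
        with prev(2) show False by simp
      next
        case True
        have succ: "g' (Suc c) \<in> Z (F v)" "odd (rank (F v) (g' (Suc c)))"
          using F[of v "Suc c"] nb(2)[OF True] by (auto simp: mem)
        have "g' (c - 1) < g' (Suc c)" using strict_emb_less[OF g' _ True, of "c - 1"] by simp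
        with no True succ(1) have "{y \<in> Z (F v). g' (c - 1) < y} = insert (g' (Suc c)) {y \<in> Z (F v). g' (Suc c) < y}"
          by (auto simp: not_less intro: le_neq_implies_less)
        then have "rank (F v) (g' (c - 1)) = Suc (rank (F v) (g' (Suc c)))"
          unfolding rank_def using Zfin by (simp only: card_insert_if) simp
        with prev succ show False by simp
      qed
    qed
    then obtain y where y: "y \<in> Z (F v)" "g' (c - 1) < y" "Suc c < k \<Longrightarrow> y < g' (Suc c)" by blast
    have yn: "y < n" using y(1) A by (auto simp: Z_def)
    define g where "g = g'(c := y)"
    have "strict_emb k n g"
    proof (rule strict_embI)
      fix i j assume ij: "i < j" "j < k"
      consider "j = c" | "i = c" | "i \<noteq> c" "j \<noteq> c" by blast
      then show "g i < g j"
      proof cases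
        case 1
        then have "g' i \<le> g' (c - 1)" using ij by (intro strict_emb_le[OF g']) auto
        with 1 ij y(2) show ?thesis by (simp add: g_def)
      next
        case 2
        then have "g' (Suc c) \<le> g' j" using ij by (intro strict_emb_le[OF g']) auto
        with 2 ij y(3) show ?thesis by (simp add: g_def)
      next
        case 3
        then show ?thesis using strict_emb_less[OF g' ij] by (simp add: g_def)
      qed
    next
      show "g i < n" if "i < k" for i using strict_emb_bound[OF g' that] yn by (simp add: g_def)
    qed
    moreover have "F w @ [g z] \<in> A" if "w @ [z] \<in> ones P" for w z
    proof (cases "z = c")
      case True
      with c(2) that y(1) show ?thesis by (auto simp: g_def Z_def)
    next
      case False
      with F[of w z] that sub show ?thesis by (auto simp: g_def)
    qed
    ultimately show ?thesis by blast
  qed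
  ultimately show "\<exists>A'\<subseteq>A. card A \<le> 2 * card A' + 2 * n ^ e \<and>
        (\<forall>F g'. strict_emb k n g' \<longrightarrow>
          (\<forall>w z. w @ [z] \<in> ones (ZOMat (dims P) (ones P - {v @ [c]})) \<longrightarrow> F w @ [g' z] \<in> A') \<longrightarrow>
          (\<exists>g. strict_emb k n g \<and> (\<forall>w z. w @ [z] \<in> ones P \<longrightarrow> F w @ [g z] \<in> A)))"
    using sub by (intro exI[of _ A']) auto
qed

text \<open>\<open>g j\<close> is the largest lower bound that strict growth and the values on
  \<open>L\<close> force; the term \<open>j\<close> serves indices before all of \<open>L\<close>.
  The hypotheses on \<open>f\<close> keep these bounds consistent on \<open>L\<close> and smaller
  than \<open>n\<close>.\<close>

lemma strict_emb_extend:
  assumes L: "L \<subseteq> {..<k}" and kn: "k \<le> n"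
    and f: "\<And>l. l \<in> L \<Longrightarrow> l \<le> f l" "\<And>l. l \<in> L \<Longrightarrow> f l + k \<le> n"
      "\<And>l l'. \<lbrakk>l \<in> L; l' \<in> L; l < l'\<rbrakk> \<Longrightarrow> f l + (l' - l) \<le> f l'"
  shows "\<exists>g. strict_emb k n g \<and> (\<forall>l\<in>L. g l = f l)"
proof -
  define X where "X j = insert j ((\<lambda>l. f l + (j - l)) ` {l \<in> L. l \<le> j})" for j
  define g where "g j = Max (X j)" for j
  have fin: "finite (X j)" "X j \<noteq> {}" for j using L finite_subset by (auto simp: X_def)
  have g_in: "g j \<in> X j" and g_ge: "x \<in> X j \<Longrightarrow> x \<le> g j" for j x
    using Max_in[OF fin] Max_ge[OF fin(1)] by (auto simp: g_def)
  have "strict_emb k n g"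
  proof (rule strict_embI)
    fix i j assume ij: "i < j" "j < k"
    have "g i + (j - i) \<in> X j" using g_in[of i] ij by (auto simp: X_def)
    from g_ge[OF this] show "g i < g j" using ij by simp
  next
    fix i assume "i < k"
    show "g i < n"
    proof -
      consider "g i = i" | l where "l \<in> L" "g i = f l + (i - l)" using g_in[of i] by (auto simp: X_def)
      then show ?thesis
        by cases (use \<open>i < k\<close> kn f(2) in \<open>fastforce+\<close>)
    qed
  qed
  moreover have "g l = f l" if l: "l \<in> L" for l
  proof (rule antisym)
    have "f l \<in> X l" using l by (force simp: X_def)
    then show "f l \<le> g l" by (rule g_ge)
    consider "g l = l" | l' where "l' \<in> L" "l' \<le> l" "g l = f l' + (l - l')" using g_in[of l] by (auto simp: X_def)
    then show "g l \<le> f l"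
    proof cases
      case 2
      then show ?thesis using f(3)[of l' l] l by (cases "l' = l") auto
    qed (use f(1) l in simp)
  qed
  ultimately show ?thesis by blast
qed

definition skip :: "nat \<Rightarrow> nat \<Rightarrow> nat" where
  "skip c z = (if z < c then z else Suc z)"

definition delete_layer :: "nat \<Rightarrow> zomat \<Rightarrow> zomat" where
  "delete_layer c P = ZOMat (butlast (dims P) @ [last (dims P) - 1]) {w @ [z] | w z. w @ [skip c z] \<in> ones P}"

lemma delete_layer_zo_matrix:
  assumes "zo_matrix (Suc e) P" "dims P = ks @ [k]" "k \<ge> 2" "c < k"
  shows "zo_matrix (Suc e) (delete_layer c P)"
proof -
  have "z < k - 1" if "skip c z < k" for z using that assms(4) by (auto simp: skip_def split: if_splits)
  then show ?thesis using assms by (auto simp: zo_matrix_def delete_layer_def) 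
qed

lemma contains_delete_layer:
  assumes "zo_matrix (Suc e) P" "dims P = ks @ [k]" "k \<ge> 2" "c < k"
  shows "contains P (delete_layer c P)"
proof -
  have "strict_emb (k - 1) k (skip c)" by (rule strict_embI) (auto simp: skip_def)
  moreover have "dims (delete_layer c P) = ks @ [k - 1]" using assms by (simp add: delete_layer_def)
  moreover have "ones (delete_layer c P) \<subseteq> positions (dims (delete_layer c P))"
    using delete_layer_zo_matrix[OF assms] by (simp add: zo_matrix_def)
  ultimately show ?thesis
    using contains_snoc[of P ks k "delete_layer c P" ks "k - 1"] assms(2) strict_emb_id
    by (auto simp: delete_layer_def intro!: exI[of _ "\<lambda>i j. j"] exI[of _ "skip c"])
qed

text \<open>
  Restrict the last coordinate to a residue class modulo \<open>k\<close>, away from the boundary. The images of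
  the nonempty layers then leave enough room for all empty ones; this includes those other than \<open>c\<close>,
  whose images are not restricted to the residue class.
\<close>

lemma bigo_ex_num_empty_layer:
  assumes P: "zo_matrix (Suc e) P" "dims P = ks @ [k]" and k: "k \<ge> 2" and c: "c < k" "\<And>w. w @ [c] \<notin> ones P"
    and O: "(\<lambda>n. real (ex_num n (delete_layer c P) (Suc e))) \<in> O(\<lambda>n. real n ^ e)"
  shows "(\<lambda>n. real (ex_num n P (Suc e))) \<in> O(\<lambda>n. real n ^ e)"
proof (rule bigo_ex_num_last_coordinate[OF P delete_layer_zo_matrix[OF P k c(1)] _ O])
  show "dims (delete_layer c P) = ks @ [k - 1]" using P by (simp add: delete_layer_def)
  fix n A assume n: "k \<le> n" and A: "A \<subseteq> positions (replicate e n @ [n])"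
  define A' where "A' r = {w @ [z] | w z. w @ [z] \<in> A \<and> k \<le> z \<and> z + k \<le> n \<and> z mod k = r}" for r
  define W where "W = positions (replicate e n)"
  have finA: "finite A" using A finite_positions finite_subset by blast
  have sub: "A' r \<subseteq> A" for r by (auto simp: A'_def)
  obtain r where r: "\<And>r'. r' < k \<Longrightarrow> card (A' r') \<le> card (A' r)"
  proof -
    have "Max ((\<lambda>r. card (A' r)) ` {..<k}) \<in> (\<lambda>r. card (A' r)) ` {..<k}"
      using k by (intro Max_in) (auto simp: lessThan_empty_iff)
    then obtain r where "card (A' r) = Max ((\<lambda>r. card (A' r)) ` {..<k})" by force
    then have "card (A' r') \<le> card (A' r)" if "r' < k" for r' using that by simp
    then show ?thesis by (rule that)
  qed
  have "card A \<le> 2 * k * card (A' r) + 2 * k * n ^ e"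
  proof -
    \<comment> \<open>The first and the last \<open>k\<close> layers hold at most
      \<open>2 * k * n ^ e\<close> positions; the rest splits into \<open>k\<close> residue classes,
      of which \<open>r\<close> is a largest.\<close>
    let ?E = "(\<lambda>(w, z). w @ [z]) ` (W \<times> ({..<k} \<union> {n - k..<n}))"
    have finE: "finite (W \<times> ({..<k} \<union> {n - k..<n}))" by (simp add: W_def finite_positions)
    have "A \<subseteq> (\<Union>r<k. A' r) \<union> ?E"
    proof
      fix x assume x: "x \<in> A"
      then obtain w z where wz: "x = w @ [z]" "w \<in> W" "z < n" using A by (auto simp: subset_iff positions_snoc W_def)
      show "x \<in> (\<Union>r<k. A' r) \<union> ?E"
      proof (cases "k \<le> z \<and> z + k \<le> n")
        case True
        then have "x \<in> A' (z mod k)" using x wz by (auto simp: A'_def)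
        then show ?thesis using k by auto
      next
        case False
        then have "(w, z) \<in> W \<times> ({..<k} \<union> {n - k..<n})" using wz by auto
        then show ?thesis using wz(1) by force
      qed
    qed
    then have "card A \<le> card ((\<Union>r<k. A' r) \<union> ?E)"
      using finE finite_subset[OF sub finA] by (intro card_mono) auto
    also have "\<dots> \<le> card (\<Union>r<k. A' r) + card ?E" by (rule card_Un_le)
    also have "card (\<Union>r<k. A' r) \<le> (\<Sum>r<k. card (A' r))" by (rule card_UN_le) simp
    also have "(\<Sum>r<k. card (A' r)) \<le> of_nat (card {..<k}) * card (A' r)"
      by (rule sum_bounded_above) (use r in auto)
    also have "card ?E \<le> card (W \<times> ({..<k} \<union> {n - k..<n}))" using finE by (rule card_image_le)
    also have "\<dots> = n ^ e * card ({..<k} \<union> {n - k..<n})"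
      by (simp add: card_cartesian_product W_def card_positions_replicate)
    also have "card ({..<k} \<union> {n - k..<n}) \<le> 2 * k"
      using card_Un_le[of "{..<k}" "{n - k..<n}"] by simp
    finally show ?thesis by (simp add: algebra_simps)
  qed
  moreover have "\<exists>g. strict_emb k n g \<and> (\<forall>w z. w @ [z] \<in> ones P \<longrightarrow> F w @ [g z] \<in> A)"
    if g': "strict_emb (k - 1) n g'"
      and F: "\<And>w z. w @ [z] \<in> ones (delete_layer c P) \<Longrightarrow> F w @ [g' z] \<in> A' r" for F g'
  proof -
    define L where "L = {l. \<exists>w. w @ [l] \<in> ones P}"
    define d where "d l = (if l < c then l else l - 1)" for l
    have Lk: "L \<subseteq> {..<k}" using P by (auto simp: L_def zo_matrix_def)
    have cL: "c \<notin> L" using c by (simp add: L_def)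
    have skip: "skip c (d l) = l" if "l \<noteq> c" for l using that by (auto simp: skip_def d_def)
    have mem: "F w @ [g' (d l)] \<in> A' r" if "w @ [l] \<in> ones P" for w l
    proof -
      have "l \<noteq> c" using that c by blast
      then show ?thesis using that F[of w "d l"] skip by (auto simp: delete_layer_def)
    qed
    have range: "k \<le> g' (d l)" "g' (d l) + k \<le> n" "g' (d l) mod k = r" if "l \<in> L" for l
      using that mem by (auto simp: L_def A'_def)
    \<comment> \<open>Distinct numbers in one residue class modulo \<open>k\<close> differ by at
      least \<open>k\<close>, which exceeds the distance of any two layers.\<close>
    have "g' (d l) + k \<le> g' (d l')" if l: "l \<in> L" "l' \<in> L" "l < l'" for l l'
    proof -
      have "l \<noteq> c" "l' \<noteq> c" "l' < k" using l cL Lk by auto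
      then have "d l < d l'" "d l' < k - 1" using l(3) c(1) by (auto simp: d_def)
      then have less: "g' (d l) < g' (d l')" by (rule strict_emb_less[OF g'])
      have "g' (d l) div k < g' (d l') div k"
      proof (rule ccontr)
        assume "\<not> ?thesis"
        then have "g' (d l') div k = g' (d l) div k" using div_le_mono[OF less_imp_le[OF less], of k] by simp
        then show False using less range(3)[OF l(1)] range(3)[OF l(2)]
          by (metis div_mult_mod_eq less_irrefl)
      qed
      then have "(g' (d l) div k + 1) * k \<le> g' (d l') div k * k" by (intro mult_le_mono1) simp
      then show ?thesis
        using range(3)[OF l(1)] range(3)[OF l(2)] div_mult_mod_eq[of "g' (d l)" k] div_mult_mod_eq[of "g' (d l')" k]
        by (simp add: algebra_simps)
    qed
    then have "g' (d l) + (l' - l) \<le> g' (d l')" if "l \<in> L" "l' \<in> L" "l < l'" for l l'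
      using that Lk by (fastforce simp: subset_iff)
    moreover have "l \<le> g' (d l)" if "l \<in> L" for l using range(1)[OF that] Lk that by fastforce
    ultimately obtain g where g: "strict_emb k n g" "\<And>l. l \<in> L \<Longrightarrow> g l = g' (d l)"
      using strict_emb_extend[OF Lk n, of "\<lambda>l. g' (d l)"] range(2) by blast
    moreover have "F w @ [g z] \<in> A" if "w @ [z] \<in> ones P" for w z
    proof -
      have "z \<in> L" using that by (auto simp: L_def)
      then show ?thesis using mem[OF that] g(2)[of z] sub by auto
    qed
    ultimately show ?thesis by blast
  qed
  ultimately show "\<exists>A'\<subseteq>A. card A \<le> 2 * k * card A' + 2 * k * n ^ e \<and>
        (\<forall>F g'. strict_emb (k - 1) n g' \<longrightarrow>
          (\<forall>w z. w @ [z] \<in> ones (delete_layer c P) \<longrightarrow> F w @ [g' z] \<in> A') \<longrightarrow>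
          (\<exists>g. strict_emb k n g \<and> (\<forall>w z. w @ [z] \<in> ones P \<longrightarrow> F w @ [g z] \<in> A)))"
    using sub by (intro exI[of _ "A' r"]) auto
qed

section \<open>Sequences without abab\<close>

text \<open>
  At a transition from \<open>a\<close> to \<open>b\<close>, either \<open>b\<close> occurs for the first time or \<open>a\<close> for the last time.
\<close>

lemma card_transitions_le:
  fixes u :: "nat \<Rightarrow> nat"
  assumes u: "\<And>c. c < N \<Longrightarrow> u c < k"
    and abab: "\<And>c1 c2 c3 c4. \<lbrakk>c1 < c2; c2 < c3; c3 < c4; c4 < N; u c1 = u c3; u c2 = u c4\<rbrakk> \<Longrightarrow> u c1 = u c2"
  shows "card {c. Suc c < N \<and> u c \<noteq> u (Suc c)} \<le> 2 * k - 2"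
proof (cases "N = 0")
  case False
  define F where "F = {c. Suc c < N \<and> (\<forall>e\<le>c. u e \<noteq> u (Suc c))}"
  define L where "L = {c. Suc c < N \<and> (\<forall>e. c < e \<longrightarrow> e < N \<longrightarrow> u e \<noteq> u c)}"
  have fin: "finite F" "finite L"
    by (rule finite_subset[of _ "{..<N}"]; auto simp: F_def L_def)+
  have "{c. Suc c < N \<and> u c \<noteq> u (Suc c)} \<subseteq> F \<union> L"
  proof
    fix c assume "c \<in> {c. Suc c < N \<and> u c \<noteq> u (Suc c)}"
    then have c: "Suc c < N" "u c \<noteq> u (Suc c)" by auto
    show "c \<in> F \<union> L"
    \<comment> \<open>Otherwise \<open>u (Suc c)\<close> occurs before \<open>c\<close> and
      \<open>u c\<close> after \<open>Suc c\<close>; with the transition itself this is an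
      \<open>abab\<close>.\<close>
    proof (rule ccontr)
      assume "c \<notin> F \<union> L"
      then obtain e e' where e: "e \<le> c" "u e = u (Suc c)" "c < e'" "e' < N" "u e' = u c"
        using c by (auto simp: F_def L_def)
      with c have "e < c" "Suc c < e'" by (metis le_neq_implies_less Suc_lessI)+
      from abab[OF this(1) lessI this(2) e(4)] e c show False by simp
    qed
  qed
  then have "card {c. Suc c < N \<and> u c \<noteq> u (Suc c)} \<le> card F + card L"
    using fin by (meson card_Un_le card_mono finite_UnI order_trans)
  moreover have "card F \<le> k - 1"
  proof -
    \<comment> \<open>The value \<open>u 0\<close> is never new later on, which saves one; dually
      for \<open>u (N - 1)\<close> and \<open>L\<close>.\<close>
    have "card F \<le> card ({..<k} - {u 0})"
    proof (rule card_inj_on_le)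
      show "inj_on (\<lambda>c. u (Suc c)) F"
      proof (rule inj_onI)
        fix x y assume xy: "x \<in> F" "y \<in> F" "u (Suc x) = u (Suc y)"
        have "u (Suc x) \<noteq> u (Suc y)" if "x < y" "y \<in> F" for x y
          using that Suc_leI[OF that(1)] unfolding F_def by blast
        with xy show "x = y" by (metis linorder_neqE_nat)
      qed
      show "(\<lambda>c. u (Suc c)) ` F \<subseteq> {..<k} - {u 0}" using u by (force simp: F_def)
    qed auto
    then show ?thesis using u[of 0] False by simp
  qed
  moreover have "card L \<le> k - 1"
  proof -
    have "card L \<le> card ({..<k} - {u (N - 1)})"
    proof (rule card_inj_on_le)
      show "inj_on u L"
      proof (rule inj_onI)
        fix x y assume xy: "x \<in> L" "y \<in> L" "u x = u y"
        have "u y \<noteq> u x" if "x < y" "x \<in> L" "y \<in> L" for x y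
          using that Suc_lessD[of y N] unfolding L_def by blast
        with xy show "x = y" by (metis linorder_neqE_nat)
      qed
      show "u ` L \<subseteq> {..<k} - {u (N - 1)}"
      proof (rule image_subsetI)
        fix c assume c: "c \<in> L"
        then have "c < N - 1" "N - 1 < N" by (auto simp: L_def)
        with c have "u (N - 1) \<noteq> u c" unfolding L_def by blast
        then show "u c \<in> {..<k} - {u (N - 1)}" using u[of c] \<open>c < N - 1\<close> by auto
      qed
    qed auto
    then show ?thesis using u[of "N - 1"] False by simp
  qed
  ultimately show ?thesis by linarith
qed simp

text \<open>\<open>Suc\<close> maps the repetitions injectively to changes, so at least half of the
  \<open>N - 1\<close> steps are changes.\<close>

lemma length_le_transitions:
  assumes "\<And>c. \<lbrakk>Suc c < N; r c = r (Suc c)\<rbrakk> \<Longrightarrow> Suc (Suc c) < N \<and> r (Suc c) \<noteq> r (Suc (Suc c))"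
  shows "N \<le> 1 + 2 * card {c. Suc c < N \<and> r c \<noteq> r (Suc c)}"
proof -
  let ?T = "{c. Suc c < N \<and> r c \<noteq> r (Suc c)}" and ?E = "{c. Suc c < N \<and> r c = r (Suc c)}"
  have fin: "finite ?T" "finite ?E" by (rule finite_subset[of _ "{..<N}"]; auto)+
  have "card ?E \<le> card ?T"
    using assms fin by (intro card_inj_on_le[of Suc]) auto
  moreover have "{..<N - 1} = ?T \<union> ?E" by auto
  then have "N - 1 = card ?T + card ?E"
    using fin by (metis (no_types, lifting) card_Un_disjoint card_lessThan disjoint_iff mem_Collect_eq)
  ultimately show ?thesis by linarith
qed

lemma list_transitions_le:
  fixes r :: "nat \<Rightarrow> nat list"
  assumes len: "\<And>c. c < N \<Longrightarrow> length (r c) = e"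
    and k: "\<And>c i. \<lbrakk>c < N; i < e\<rbrakk> \<Longrightarrow> r c ! i < k i"
    and abab: "\<And>i c1 c2 c3 c4. \<lbrakk>i < e; c1 < c2; c2 < c3; c3 < c4; c4 < N;
       r c1 ! i = r c3 ! i; r c2 ! i = r c4 ! i\<rbrakk> \<Longrightarrow> r c1 ! i = r c2 ! i"
  shows "card {c. Suc c < N \<and> r c \<noteq> r (Suc c)} \<le> (\<Sum>i<e. 2 * k i - 2)"
proof -
  have "{c. Suc c < N \<and> r c \<noteq> r (Suc c)} \<subseteq> (\<Union>i<e. {c. Suc c < N \<and> r c ! i \<noteq> r (Suc c) ! i})"
    using len by (force simp: list_eq_iff_nth_eq)
  moreover have fin: "finite (\<Union>i<e. {c. Suc c < N \<and> r c ! i \<noteq> r (Suc c) ! i})"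
    by (rule finite_subset[of _ "{..<N}"]) auto
  ultimately have "card {c. Suc c < N \<and> r c \<noteq> r (Suc c)}
      \<le> card (\<Union>i<e. {c. Suc c < N \<and> r c ! i \<noteq> r (Suc c) ! i})"
    by (intro card_mono)
  also have "\<dots> \<le> (\<Sum>i<e. card {c. Suc c < N \<and> r c ! i \<noteq> r (Suc c) ! i})"
    by (rule card_UN_le) simp
  also have "\<dots> \<le> (\<Sum>i<e. 2 * k i - 2)"
  proof (rule sum_mono)
    fix i assume "i \<in> {..<e}"
    then have i: "i < e" by simp
    show "card {c. Suc c < N \<and> r c ! i \<noteq> r (Suc c) ! i} \<le> 2 * k i - 2"
      using card_transitions_le[of N "\<lambda>c. r c ! i" "k i"] k[OF _ i] abab[OF i] by blast
  qed
  finally show ?thesis .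
qed

section \<open>The bound\<close>

text \<open>\<open>up\<close> records the order of the two rows; for \<open>a > b\<close>,
  reflecting the rows reduces to \<open>a < b\<close>.\<close>

lemma abab_superlinear:
  obtains n M where "t \<le> n" "M \<subseteq> {..<n} \<times> {..<n}" "C * n \<le> card M"
    "\<And>a b c1 c2 c3 c4. \<lbrakk>a \<noteq> b; a < b \<longleftrightarrow> up; c1 < c2; c2 < c3; c3 < c4;
       (a, c1) \<in> M; (b, c2) \<in> M; (a, c3) \<in> M; (b, c4) \<in> M\<rbrakk> \<Longrightarrow> False"
proof -
  obtain n M where M: "t \<le> n" "M \<subseteq> {..<n} \<times> {..<n}" "abab_free M" "C * n \<le> card M"
    using abab_free_superlinear by blast
  show ?thesis
  proof (cases up)
    case True
    show ?thesis
    proof (rule that[OF M(1,2,4)])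
      fix a b c1 c2 c3 c4
      assume "a < b \<longleftrightarrow> up" and *: "c1 < c2" "c2 < c3" "c3 < c4" "(a, c1) \<in> M" "(b, c2) \<in> M" "(a, c3) \<in> M" "(b, c4) \<in> M"
      then have "a < b" using True by simp
      from abab_freeD[OF M(3) this *] show False .
    qed
  next
    case False
    define M' where "M' = (\<lambda>(r, c). (n - 1 - r, c)) ` M"
    have unrefl: "r < n \<and> (n - 1 - r, c) \<in> M" if "(r, c) \<in> M'" for r c
      using that M(2) by (auto simp: M'_def)
    have "inj_on (\<lambda>(r, c). (n - 1 - r, c)) M"
      by (rule inj_on_inverseI[of _ "\<lambda>(r, c). (n - 1 - r, c)"]) (use M(2) in auto)
    then have "card M' = card M" unfolding M'_def by (rule card_image)
    moreover have "M' \<subseteq> {..<n} \<times> {..<n}" using M(2) by (auto simp: M'_def)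
    ultimately show ?thesis
    proof (intro that[of n M'])
      fix a b c1 c2 c3 c4
      assume ab: "a \<noteq> b" "a < b \<longleftrightarrow> up" and less: "c1 < c2" "c2 < c3" "c3 < c4"
        and *: "(a, c1) \<in> M'" "(b, c2) \<in> M'" "(a, c3) \<in> M'" "(b, c4) \<in> M'"
      have "n - 1 - a < n - 1 - b" using ab False unrefl[OF *(1)] by auto
      from abab_freeD[OF M(3) this less] unrefl * show False by blast
    qed (use M in auto)
  qed
qed

lemma abab_not_bigo:
  assumes P: "zo_matrix (Suc e) P" "dims P = ks @ [k]" and i: "i < e"
    and ones: "w1 @ [c1] \<in> ones P" "w2 @ [c2] \<in> ones P" "w3 @ [c3] \<in> ones P" "w4 @ [c4] \<in> ones P"
    and c: "c1 < c2" "c2 < c3" "c3 < c4"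
    and w: "w1 ! i = w3 ! i" "w2 ! i = w4 ! i" "w1 ! i \<noteq> w2 ! i"
  shows "(\<lambda>n. real (ex_num n P (Suc e))) \<notin> O(\<lambda>n. real n ^ e)"
proof
  assume "(\<lambda>n. real (ex_num n P (Suc e))) \<in> O(\<lambda>n. real n ^ e)"
  then obtain \<alpha> where "eventually (\<lambda>n. norm (real (ex_num n P (Suc e))) \<le> \<alpha> * norm (real n ^ e)) sequentially"
    by (elim landau_o.bigE)
  then obtain N where N: "\<And>n. n \<ge> N \<Longrightarrow> real (ex_num n P (Suc e)) \<le> \<alpha> * real n ^ e"
    by (auto simp: eventually_sequentially)
  define C where "C = Suc (nat \<lceil>\<alpha>\<rceil>)"
  have C: "\<alpha> < real C" unfolding C_def by linarith
  obtain n M where n: "max N 1 \<le> n" and M: "M \<subseteq> {..<n} \<times> {..<n}" "C * n \<le> card M"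
    and free: "\<And>a b c1 c2 c3 c4. \<lbrakk>a \<noteq> b; a < b \<longleftrightarrow> w1 ! i < w2 ! i; c1 < c2; c2 < c3; c3 < c4;
       (a, c1) \<in> M; (b, c2) \<in> M; (a, c3) \<in> M; (b, c4) \<in> M\<rbrakk> \<Longrightarrow> False"
    by (rule abab_superlinear[of "max N 1" C "w1 ! i < w2 ! i"]) blast
  \<comment> \<open>\<open>A\<close> follows \<open>M\<close> in coordinate \<open>i\<close> and the
    last one and is constant in the others. A copy of \<open>P\<close> projects to an alternation in
    \<open>M\<close>, and there are at least \<open>card M * n ^ (e - 1)\<close> entries.\<close>
  define A where "A = ZOMat (replicate e n @ [n])
    {w @ [z] | w z. w \<in> positions (replicate e n) \<and> z < n \<and> (w ! i, z) \<in> M}"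
  have lks: "length ks = e" using P by (auto simp: zo_matrix_def)
  have pos: "ones P \<subseteq> positions (ks @ [k])" using P by (auto simp: zo_matrix_def)
  have bounds: "w ! i < ks ! i" "length w = e" "z < k" if "w @ [z] \<in> ones P" for w z
  proof -
    have "w @ [z] \<in> positions (ks @ [k])" using that pos by blast
    then show "w ! i < ks ! i" "length w = e" "z < k" using i lks by (auto simp: positions_conv_nth[of w])
  qed
  have "\<not> contains A P"
  proof
    assume "contains A P"
    then obtain \<phi> g where \<phi>: "\<And>i. i < length ks \<Longrightarrow> strict_emb (ks ! i) (replicate e n ! i) (\<phi> i)"
      and g: "strict_emb k n g" and emb: "\<And>w z. w @ [z] \<in> ones P \<Longrightarrow> emb \<phi> w @ [g z] \<in> ones A"
      using contains_snoc[of A "replicate e n" n P ks k] P pos lks by (auto simp: A_def)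
    have \<phi>i: "strict_emb (ks ! i) (replicate e n ! i) (\<phi> i)" using \<phi> i lks by blast
    have mem: "(\<phi> i (w ! i), g z) \<in> M" if "w @ [z] \<in> ones P" for w z
      using emb[OF that] bounds(2)[OF that] i by (auto simp: A_def nth_emb)
    let ?a = "\<phi> i (w1 ! i)" and ?b = "\<phi> i (w2 ! i)"
    have "?a < ?b" if "w1 ! i < w2 ! i"
      using strict_emb_less[OF \<phi>i that] bounds(1)[OF ones(2)] by simp
    moreover have "?b < ?a" if "w2 ! i < w1 ! i"
      using strict_emb_less[OF \<phi>i that] bounds(1)[OF ones(1)] by simp
    ultimately have "?a \<noteq> ?b" "?a < ?b \<longleftrightarrow> w1 ! i < w2 ! i" using w(3)
      by (metis less_asym linorder_neqE_nat less_irrefl)+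
    moreover have "g c1 < g c2" "g c2 < g c3" "g c3 < g c4"
      using strict_emb_less[OF g] c bounds(3) ones by blast+
    moreover have "(?a, g c1) \<in> M" "(?b, g c2) \<in> M" "(?a, g c3) \<in> M" "(?b, g c4) \<in> M"
      using mem[OF ones(1)] mem[OF ones(2)] mem[OF ones(3)] mem[OF ones(4)] w(1,2) by simp_all
    ultimately show False by (rule free)
  qed
  moreover have zoA: "zo_matrix (Suc e) A" using n by (auto simp: zo_matrix_def A_def)
  ultimately have "A \<in> free_matrices n P (Suc e)"
    by (auto simp: free_matrices_def A_def replicate_append_same)
  then have "card (ones A) \<le> ex_num n P (Suc e)" by (rule card_le_ex_num)
  moreover have "C * n ^ e \<le> card (ones A)"
  proof -
    let ?Y = "positions (replicate (e - 1) n)"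
    define f where "f = (\<lambda>((r :: nat, z), y). (take i y @ [r] @ drop i y) @ [z])"
    have "card (M \<times> ?Y) \<le> card (ones A)"
    proof (rule card_inj_on_le)
      show "inj_on f (M \<times> ?Y)"
      proof (rule inj_onI)
        fix p p' assume p: "p \<in> M \<times> ?Y" "p' \<in> M \<times> ?Y" "f p = f p'"
        obtain r z y r' z' y' where [simp]: "p = ((r, z), y)" "p' = ((r', z'), y')"
          by (cases p; cases p') auto
        have *: "y \<in> ?Y" "y' \<in> ?Y" "f ((r, z), y) = f ((r', z'), y')" using p by auto
        then have "length (take i y) = length (take i y')" by (auto simp: positions_conv_nth)
        with *(3) have "take i y = take i y'" "drop i y = drop i y'" "r = r'" "z = z'"
          by (auto simp: f_def)
        then show "p = p'" by simp (metis append_take_drop_id)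
      qed
      show "f ` (M \<times> ?Y) \<subseteq> ones A"
      proof (rule image_subsetI, clarify)
        fix r z y assume *: "(r, z) \<in> M" "y \<in> ?Y"
        have ly: "length y = e - 1" "\<And>j. j < e - 1 \<Longrightarrow> y ! j < n" using *(2) by (auto simp: positions_conv_nth)
        let ?w = "take i y @ [r] @ drop i y"
        have rz: "r < n" "z < n" using M(1) *(1) by auto
        have "length ?w = e" using ly i by simp
        moreover have "?w ! j < n" if "j < e" for j
          using that ly i rz by (auto simp: nth_append min_def nth_Cons')
        ultimately have "?w \<in> positions (replicate e n)" by (simp add: positions_conv_nth)
        moreover have "?w ! i = r" using ly i by (simp add: nth_append)
        ultimately show "f ((r, z), y) \<in> ones A" using * rz by (auto simp: f_def A_def)
      qed
      show "finite (ones A)" using zoA finite_positions finite_subset by (auto simp: zo_matrix_def)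
    qed
    moreover have "C * n ^ e = C * n * n ^ (e - 1)" using i by (cases e) auto
    moreover have "C * n * n ^ (e - 1) \<le> card M * n ^ (e - 1)" using M(2) by (rule mult_le_mono1)
    ultimately show ?thesis unfolding card_cartesian_product card_positions_replicate by linarith
  qed
  ultimately have "C * n ^ e \<le> ex_num n P (Suc e)" by linarith
  then have "real C * real n ^ e \<le> real (ex_num n P (Suc e))"
    by (metis of_nat_le_iff of_nat_mult of_nat_power)
  also have "\<dots> \<le> \<alpha> * real n ^ e" using N n by simp
  finally have "real C \<le> \<alpha>" using n by simp
  with C show False by simp
qed

text \<open>Each choice depends on the preceding one. Equal neighbours then certify that the later
  layer has a single entry, as \<open>bigo_ex_num_isolated_one\<close> requires.\<close>

lemma layer_representatives:
  assumes "\<And>c. c < k \<Longrightarrow> \<exists>w. w @ [c] \<in> X"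
  shows "\<exists>r. \<forall>c. (c < k \<longrightarrow> r c @ [c] \<in> X) \<and>
    (Suc c < k \<longrightarrow> r (Suc c) = r c \<longrightarrow> (\<forall>w. w @ [Suc c] \<in> X \<longrightarrow> w = r c))"
proof (rule dependent_nat_choice)
  show "\<exists>w. 0 < k \<longrightarrow> w @ [0] \<in> X" using assms by blast
  fix v c
  show "\<exists>w. (Suc c < k \<longrightarrow> w @ [Suc c] \<in> X) \<and>
      (Suc c < k \<longrightarrow> w = v \<longrightarrow> (\<forall>w'. w' @ [Suc c] \<in> X \<longrightarrow> w' = v))"
    using assms[of "Suc c"] by metis
qed

theorem theorem3p20:
  fixes d :: nat and P :: zomat and k :: "nat \<Rightarrow> nat"
  assumes "d \<ge> 1"
    and "minimally_non_O d P"
    and "dims P = map k [1..<Suc d]"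
    and "\<And>i j. 1 \<le> i \<Longrightarrow> i \<le> j \<Longrightarrow> j \<le> d \<Longrightarrow> k i \<le> k j"
  shows "int (k d) \<le> 1 + 2 * (\<Sum>i = 1..d - 1. (2 * int (k i) - 2))"
proof -
  obtain e where d: "d = Suc e" using assms(1) by (cases d) auto
  define ks where "ks = map k [1..<d]"
  have dims: "dims P = ks @ [k d]" using assms(1,3) by (simp add: ks_def)
  have lks: "length ks = e" and nth_ks: "\<And>i. i < e \<Longrightarrow> ks ! i = k (Suc i)"
    by (simp_all add: ks_def d del: upt_Suc)
  have zo: "zo_matrix (Suc e) P" and \<omega>: "(\<lambda>n. real (ex_num n P (Suc e))) \<in> \<omega>(\<lambda>n. real n ^ e)"
    and minimal: "\<And>P'. \<lbrakk>zo_matrix (Suc e) P'; contains P P'; P' \<noteq> P\<rbrakk> \<Longrightarrow>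
      (\<lambda>n. real (ex_num n P' (Suc e))) \<in> O(\<lambda>n. real n ^ e)"
    using assms(2) by (auto simp: minimally_non_O_def properly_contains_def d)
  have notO: "(\<lambda>n. real (ex_num n P (Suc e))) \<notin> O(\<lambda>n. real n ^ e)"
    using not_smallomega_and_bigo_power[OF \<omega>] by blast
  have pos: "ones P \<subseteq> positions (dims P)" using zo by (simp add: zo_matrix_def)
  have fewer: "(\<lambda>n. real (ex_num n (ZOMat (dims P) S) (Suc e))) \<in> O(\<lambda>n. real n ^ e)"
    if "S \<subseteq> ones P" "S \<noteq> ones P" for S
  proof (rule minimal)
    show "zo_matrix (Suc e) (ZOMat (dims P) S)" using zo that by (auto simp: zo_matrix_def)
    show "contains P (ZOMat (dims P) S)" using contains_fewer_ones pos that by blast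
    show "ZOMat (dims P) S \<noteq> P" using that by (metis zomat.sel(2))
  qed
  have k_pos: "1 \<le> k (Suc i)" if "i \<le> e" for i
  proof -
    have "k (Suc i) \<in> set (dims P)" using that by (simp add: assms(3) d del: upt_Suc)
    then show ?thesis using zo by (auto simp: zo_matrix_def Suc_le_eq)
  qed
  have sum_eq: "(\<Sum>i = 1..d - 1. (2 * int (k i) - 2)) = int (\<Sum>i<e. 2 * k (Suc i) - 2)"
  proof -
    have "(\<Sum>i = 1..d - 1. (2 * int (k i) - 2)) = (\<Sum>i<e. 2 * int (k (Suc i)) - 2)"
      by (simp add: d sum.atLeast1_atMost_eq)
    also have "\<dots> = (\<Sum>i<e. int (2 * k (Suc i) - 2))"
      using k_pos by (intro sum.cong) (auto simp: of_nat_diff)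
    finally show ?thesis by simp
  qed
  show ?thesis
  \<comment> \<open>Deleting a layer must leave a positive side length; with a single layer the
    bound is trivial.\<close>
  proof (cases "k d \<ge> 2")
    case False
    then show ?thesis unfolding sum_eq by linarith
  next
    case k2: True
    have nonempty: "\<exists>w. w @ [c] \<in> ones P" if c: "c < k d" for c
    proof (rule ccontr)
      assume empty: "\<nexists>w. w @ [c] \<in> ones P"
      have "delete_layer c P \<noteq> P"
      proof
        assume "delete_layer c P = P"
        then have "dims (delete_layer c P) = dims P" by simp
        then show False using k2 by (simp add: delete_layer_def dims)
      qed
      with minimal delete_layer_zo_matrix[OF zo dims k2 c] contains_delete_layer[OF zo dims k2 c]
      have "(\<lambda>n. real (ex_num n (delete_layer c P) (Suc e))) \<in> O(\<lambda>n. real n ^ e)" by blast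
      from bigo_ex_num_empty_layer[OF zo dims k2 c _ this] empty notO show False by blast
    qed
    obtain r where r: "\<And>c. c < k d \<Longrightarrow> r c @ [c] \<in> ones P"
      and r_single: "\<And>c w. \<lbrakk>Suc c < k d; r (Suc c) = r c; w @ [Suc c] \<in> ones P\<rbrakk> \<Longrightarrow> w = r c"
      using layer_representatives[of "k d" "ones P"] nonempty by blast
    have r_bound: "length (r c) = e" "\<And>i. i < e \<Longrightarrow> r c ! i < k (Suc i)" if "c < k d" for c
    proof -
      have "r c @ [c] \<in> positions (ks @ [k d])" using r[OF that] pos dims by auto
      then show "length (r c) = e" "\<And>i. i < e \<Longrightarrow> r c ! i < k (Suc i)"
        using lks nth_ks by (auto simp: positions_conv_nth[of "r c"])
    qed
    show ?thesis
    proof (cases "\<exists>i c1 c2 c3 c4. i < e \<and> c1 < c2 \<and> c2 < c3 \<and> c3 < c4 \<and> c4 < k d \<and>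
        r c1 ! i = r c3 ! i \<and> r c2 ! i = r c4 ! i \<and> r c1 ! i \<noteq> r c2 ! i")
      case False
      have repeat: "Suc (Suc c) < k d \<and> r (Suc c) \<noteq> r (Suc (Suc c))"
        if c: "Suc c < k d" "r c = r (Suc c)" for c
      proof (rule ccontr)
        assume contra: "\<not> ?thesis"
        have "(\<lambda>n. real (ex_num n P (Suc e))) \<in> O(\<lambda>n. real n ^ e)"
        proof (rule bigo_ex_num_isolated_one[OF zo dims])
          show "r c @ [Suc c] \<in> ones P" using r[OF c(1)] c(2) by simp
          show "w = r c" if "w @ [Suc c] \<in> ones P" for w
            using r_single[OF c(1) c(2)[symmetric] that] .
          show "r c @ [Suc c - 1] \<in> ones P" using r[of c] c(1) by simp
          show "r c @ [Suc (Suc c)] \<in> ones P" if "Suc (Suc c) < k d" using r[OF that] contra that c(2) by simp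
          show "(\<lambda>n. real (ex_num n (ZOMat (dims P) (ones P - {r c @ [Suc c]})) (Suc e))) \<in> O(\<lambda>n. real n ^ e)"
            using r[OF c(1)] c(2) by (intro fewer) auto
        qed simp
        with notO show False by contradiction
      qed
      have "k d \<le> 1 + 2 * card {c. Suc c < k d \<and> r c \<noteq> r (Suc c)}"
        using repeat by (rule length_le_transitions)
      also have "card {c. Suc c < k d \<and> r c \<noteq> r (Suc c)} \<le> (\<Sum>i<e. 2 * k (Suc i) - 2)"
        using r_bound False by (intro list_transitions_le) blast+
      finally have "k d \<le> 1 + 2 * (\<Sum>i<e. 2 * k (Suc i) - 2)" by simp
      then show ?thesis unfolding sum_eq by linarith
    next
      case True
      then obtain i c1 c2 c3 c4 where i: "i < e" and c: "c1 < c2" "c2 < c3" "c3 < c4" and c4: "c4 < k d"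
        and eq: "r c1 ! i = r c3 ! i" "r c2 ! i = r c4 ! i" "r c1 ! i \<noteq> r c2 ! i" by blast
      let ?S = "(\<lambda>c. r c @ [c]) ` {c1, c2, c3, c4}"
      have S: "?S \<subseteq> ones P" using r c c4 by auto
      have "zo_matrix (Suc e) (ZOMat (dims P) ?S)" using zo S by (auto simp: zo_matrix_def)
      then have "(\<lambda>n. real (ex_num n (ZOMat (dims P) ?S) (Suc e))) \<notin> O(\<lambda>n. real n ^ e)"
        by (rule abab_not_bigo[where ks = ks and k = "k d" and ?w1.0 = "r c1" and ?w2.0 = "r c2"
            and ?w3.0 = "r c3" and ?w4.0 = "r c4", OF _ _ i _ _ _ _ c eq]) (simp_all add: dims)
      \<comment> \<open>\<open>?S\<close> keeps the dimensions of \<open>P\<close>, so minimality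
        rules out that it omits an entry. As no layer is empty, there are at most four.\<close>
      with fewer S have "ones P = ?S" by blast
      then have "{..<k d} \<subseteq> {c1, c2, c3, c4}" using nonempty by fastforce
      then have "card {..<k d} \<le> card {c1, c2, c3, c4}" by (rule card_mono[rotated]) simp
      also have "\<dots> \<le> 4" by (simp add: card_insert_if)
      finally have "k d \<le> 4" by simp
      \<comment> \<open>Coordinate \<open>i\<close> takes two values, so the right-hand side is at
        least \<open>1 + 2 * 2\<close>, which exceeds four.\<close>
      moreover have "2 \<le> k (Suc i)"
        using r_bound(2)[of c1 i] r_bound(2)[of c2 i] i c c4 eq(3) by linarith
      then have "2 \<le> (\<Sum>i<e. 2 * k (Suc i) - 2)"
        using member_le_sum[of i "{..<e}" "\<lambda>i. 2 * k (Suc i) - 2"] i by simp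
      ultimately show ?thesis unfolding sum_eq by linarith
    qed
  qed
qed

end
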